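(* Assume that conditions $\mathbf{A}$, $\mathbf{B}$, $\mathbf{C}$ stated in the context hold, let $\delta$ be as in the context, let $k\ge0$ be an integer, and let $\rho<\delta$ be real. If $\rho=0$, assume also that condition $\mathbf{P}_{k+1}^*$ stated in the context holds (for $\rho=0$). If $\rho\ne0$, assume also that condition $\mathbf{P}_k^*$ stated in the context holds (for this $\rho$). Let $j,s\in\{1,\dots,N\}$. Then, as $\varepsilon\to0$: (i) The following asymptotic expansion holds: $$\boldsymbol{\omega}_{js}^{(\varepsilon)}(\rho)=\boldsymbol{\omega}_{js}[\rho,0,0]+\boldsymbol{\omega}_{js}[\rho,0,1]\varepsilon+\cdots+\boldsymbol{\omega}_{js}[\rho,0,k]\varepsilon^k+\mathbf{o}(\varepsilon^k),$$ where $\boldsymbol{\omega}_{js}[\rho,0,0]=\boldsymbol{\omega}_{js}^{(0)}(\rho)$ and $$\boldsymbol{\omega}_{js}[\rho,0,n]=\sum_{q=0}^n{}_j\mathbf{U}[\rho,q]\,\widehat{\boldsymbol{\varphi}}_s[\rho,0,n-q],\qquad n=1,\dots,k.$$ (ii) For $r=1,\dots,k$, the following asymptotic expansion holds: $$\boldsymbol{\omega}_{js}^{(\varepsilon)}(\rho,r)=\boldsymbol{\omega}_{js}[\rho,r,0]+\boldsymbol{\omega}_{js}[\rho,r,1]\varepsilon+\cdots+\boldsymbol{\omega}_{js}[\rho,r,k-r]\varepsilon^{k-r}+\mathbf{o}(\varepsilon^{k-r}),$$ where $\boldsymbol{\omega}_{js}[\rho,r,0]=\boldsymbol{\omega}_{js}^{(0)}(\rho,r)$,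 $$\boldsymbol{\omega}_{js}[\rho,r,n]=\sum_{q=0}^n{}_j\mathbf{U}[\rho,q]\,\boldsymbol{\theta}_{js}[\rho,r,n-q],\qquad n=1,\dots,k-r,$$ and, for $t=0,\dots,k-r$, $$\boldsymbol{\theta}_{js}[\rho,r,t]=\widehat{\boldsymbol{\varphi}}_s[\rho,r,t]+\sum_{m=1}^r\binom{r}{m}\sum_{q=0}^t{}_j\mathbf{P}[\rho,m,q]\,\boldsymbol{\omega}_{js}[\rho,r-m,t-q].$$
   Context: **Process.** Let $X=\{0,1,\dots,N\}$ with $N\ge 1$, and $\mathbb{N}=\{1,2,\dots\}$. For every $\varepsilon\ge 0$ let $(\eta_n^{(\varepsilon)},\kappa_n^{(\varepsilon)})$, $n=0,1,\dots$, be a discrete time Markov renewal process, i.e. a homogeneous Markov chain on $X\times\mathbb{N}$ whose transition probabilities do not depend on the current value of the second component: $Q_{ij}^{(\varepsilon)}(k)=\mathsf{P}\{\eta_{n+1}^{(\varepsilon)}=j,\ \kappa_{n+1}^{(\varepsilon)}=k\mid \eta_n^{(\varepsilon)}=i,\ \kappa_n^{(\varepsilon)}=l\}$, and put $Q_{ij}^{(\varepsilon)}(0)=0$. Let $p_{ij}^{(\varepsilon)}=\sum_{k\ge1}Q_{ij}^{(\varepsilon)}(k)$ be the transition probabilities of the embedded chain $\eta_n^{(\varepsilon)}$, and write $Q_{ij}^{(\varepsilon)}(k)=p_{ij}^{(\varepsilon)}f_{ij}^{(\varepsilon)}(k)$, where $f_{ij}^{(\varepsilon)}(k)=\mathsf{P}\{\kappa_{n+1}^{(\varepsilon)}=k\mid\eta_n^{(\varepsilon)}=i,\eta_{n+1}^{(\varepsilon)}=j\}$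 is a (proper) probability distribution on $\mathbb{N}$. Let $\tau^{(\varepsilon)}(0)=0$, $\tau^{(\varepsilon)}(n)=\kappa_1^{(\varepsilon)}+\cdots+\kappa_n^{(\varepsilon)}$, $\nu^{(\varepsilon)}(n)=\max\{k:\tau^{(\varepsilon)}(k)\le n\}$, and let $\xi^{(\varepsilon)}(n)=\eta^{(\varepsilon)}_{\nu^{(\varepsilon)}(n)}$ be the associated semi-Markov process. First hitting times: $\nu_j^{(\varepsilon)}=\min\{n\ge1:\eta_n^{(\varepsilon)}=j\}$ and $\mu_j^{(\varepsilon)}=\tau^{(\varepsilon)}(\nu_j^{(\varepsilon)})$, with values in $\{1,2,\dots,\infty\}$. $\mathsf{P}_i,\mathsf{E}_i$ denote probability and expectation conditional on $\eta_0^{(\varepsilon)}=i$. **Functionals** (with $0^0=1$), for $\rho\in\mathbb{R}$, $r=0,1,\dots$, $i,j,s\in X$: $g_{ij}^{(\varepsilon)}(n)=\mathsf{P}_i\{\mu_j^{(\varepsilon)}=n,\ \nu_0^{(\varepsilon)}>\nu_j^{(\varepsilon)}\}$ for $n=0,1,\dots$, $g_{ij}^{(\varepsilon)}=\mathsf{P}_i\{\nu_0^{(\varepsilon)}>\nu_j^{(\varepsilon)}\}$, $\phi_{ij}^{(\varepsilon)}(\rho)=\sum_{n\ge0}e^{\rho n}g_{ij}^{(\varepsilon)}(n)$, $p_{ij}^{(\varepsilon)}(\rho,r)=\sum_{n\ge0}n^re^{\rho n}Q_{ij}^{(\varepsilon)}(n)$, $p_{ij}^{(\varepsilon)}(\rho)=p_{ij}^{(\varepsilon)}(\rho,0)$,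 $\omega_{ijs}^{(\varepsilon)}(\rho,r)=\sum_{n\ge0}n^re^{\rho n}\mathsf{P}_i\{\xi^{(\varepsilon)}(n)=s,\ \mu_0^{(\varepsilon)}\wedge\mu_j^{(\varepsilon)}>n\}$, $\omega_{ijs}^{(\varepsilon)}(\rho)=\omega_{ijs}^{(\varepsilon)}(\rho,0)$, $\varphi_i^{(\varepsilon)}(\rho)=\mathsf{E}_i\kappa_1^{(\varepsilon)}$ if $\rho=0$ and $\varphi_i^{(\varepsilon)}(\rho)=(\mathsf{E}_ie^{\rho\kappa_1^{(\varepsilon)}}-1)/(e^\rho-1)$ if $\rho\ne0$. **Conditions.** $\mathbf{A}$: (a) $p_{ij}^{(\varepsilon)}\to p_{ij}^{(0)}$ as $\varepsilon\to0$, for $i\ne0$, $j\in X$; (b) $f_{ij}^{(\varepsilon)}(n)\to f_{ij}^{(0)}(n)$ as $\varepsilon\to0$, for $n\in\mathbb{N}$, $i\ne0$, $j\in X$. $\mathbf{B}$: $g_{ij}^{(0)}>0$ for all $i,j\ne0$. $\mathbf{C}$: there exists $\beta>0$ such that (a) $\limsup_{0\le\varepsilon\to0}p_{ij}^{(\varepsilon)}(\beta)<\infty$ for all $i\ne0$, $j\in X$ (i.e. $p_{ij}^{(\varepsilon)}(\beta)$ is bounded for $\varepsilon\ge0$ small enough, including $\varepsilon=0$); (b) $\phi_{ii}^{(0)}(\beta_i)\in(1,\infty)$ for some $i\ne0$ and some $\beta_i\le\beta$. **The parameter $\delta$.** Under $\mathbf{A}$–$\mathbf{C}$ there exists $\delta\in(0,\beta]$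 with the following properties, and $\delta$ denotes such a number: $\phi_{kj}^{(\varepsilon)}(\rho)\to\phi_{kj}^{(0)}(\rho)<\infty$ and $\omega_{kjs}^{(\varepsilon)}(\rho)\to\omega_{kjs}^{(0)}(\rho)<\infty$ as $\varepsilon\to0$ for all $\rho\le\delta$ and $k,j,s\ne0$; $\phi_{jj}^{(0)}(\delta)\in(1,\infty)$ for $j\ne0$; for sufficiently small $\varepsilon$ the equation $\phi_{ii}^{(\varepsilon)}(\rho)=1$ has a unique non-negative root $\rho^{(\varepsilon)}$, independent of $i\neq 0$; and $\rho^{(\varepsilon)}\to\rho^{(0)}<\delta$. **Condition $\mathbf{P}_k^*$** (for a given $\rho<\delta$): for $r=0,\dots,k$, $i\ne0$, $j\in X$, $p_{ij}^{(\varepsilon)}(\rho,r)=p_{ij}^{(0)}(\rho,r)+p_{ij}[\rho,r,1]\varepsilon+\cdots+p_{ij}[\rho,r,k-r]\varepsilon^{k-r}+o(\varepsilon^{k-r})$ as $\varepsilon\to0$, with all coefficients $p_{ij}[\rho,r,n]$ finite. Put $p_{ij}[\rho,r,0]=p_{ij}^{(0)}(\rho,r)$. Condition $\mathbf{P}_{k+1}^*$ is the same with $k+1$ in place of $k$. **Vectors and matrices** ($j,s\ne0$). $\boldsymbol{\omega}_{js}^{(\varepsilon)}(\rho,r)=[\omega_{1js}^{(\varepsilon)}(\rho,r)\ \cdots\ \omega_{Njs}^{(\varepsilon)}(\rho,r)]^T$, $\boldsymbol{\omega}_{js}^{(\varepsilon)}(\rho)=\boldsymbol{\omega}_{js}^{(\varepsilon)}(\rho,0)$.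 ${}_j\mathbf{P}^{(\varepsilon)}(\rho)$ is the $N\times N$ matrix with $(i,k)$ entry $p_{ik}^{(\varepsilon)}(\rho)$ if $k\ne j$ and $0$ if $k=j$; ${}_j\mathbf{P}[\rho,r,n]$ is the $N\times N$ matrix with $(i,k)$ entry $p_{ik}[\rho,r,n]$ if $k\ne j$ and $0$ if $k=j$ ($i,k\in\{1,\dots,N\}$). The matrices ${}_j\mathbf{U}[\rho,n]$ are defined by ${}_j\mathbf{U}[\rho,0]=(\mathbf{I}-{}_j\mathbf{P}^{(0)}(\rho))^{-1}$ (the inverse exists under $\mathbf{A}$–$\mathbf{C}$ for $\rho\le\delta$) and ${}_j\mathbf{U}[\rho,n]={}_j\mathbf{U}[\rho,0]\sum_{q=1}^n{}_j\mathbf{P}[\rho,0,q]\,{}_j\mathbf{U}[\rho,n-q]$ for $n=1,\dots,k$. $\mathbf{o}(\varepsilon^p)$ denotes a matrix- (or vector-) valued function of $\varepsilon$ all of whose elements are $o(\varepsilon^p)$ as $\varepsilon\to0$. **Coefficients $\widehat{\boldsymbol{\varphi}}_s[\rho,r,n]$.** For $r=0,\dots,k$, $n=0,\dots,k-r$: $\widehat{\boldsymbol{\varphi}}_s[\rho,r,n]=[\delta(1,s)\varphi_1[\rho,r,n]\ \cdots\ \delta(N,s)\varphi_N[\rho,r,n]]^T$, where $\delta(\cdot,\cdot)$ is the Kronecker delta and $\varphi_i[\rho,r,n]$ are the coefficients of the expansion $\varphi_i^{(\varepsilon)}(\rho,r)=\varphi_i[\rho,r,0]+\cdots+\varphi_i[\rho,r,k-r]\varepsilon^{k-r}+o(\varepsilon^{k-r})$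 of the $r$-th derivative $\varphi_i^{(\varepsilon)}(\rho,r)$ of $\varphi_i^{(\varepsilon)}$ at $\rho$. Explicitly, with $\psi_i[\rho,r,n]=\sum_{j\in X}p_{ij}[\rho,r,n]$: if $\rho=0$, $\varphi_i[0,r,n]=\frac{1}{r+1}\big(\psi_i[0,r+1,n]-\sum_{m=0}^{r-1}\binom{r+1}{m}\varphi_i[0,m,n]\big)$; if $\rho\ne0$, $\varphi_i[\rho,r,n]=\frac{1}{e^\rho-1}\big(\psi_i[\rho,r,n]-e^\rho\sum_{m=0}^{r-1}\binom{r}{m}\varphi_i[\rho,m,n]\big)$ for $(r,n)\ne(0,0)$, and $\varphi_i[\rho,0,0]=\varphi_i^{(0)}(\rho)=(\psi_i[\rho,0,0]-1)/(e^\rho-1)$. *)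

theory Defs
  imports "HOL-Probability.Probability" "HOL-Library.Landau_Symbols"
begin

(* The state space {0, 1, ..., N} is 'n option: None is the distinguished state 0 and
   Some i, for i in the nonempty finite type 'n with N elements, are the states 1, ..., N.
   Thus vectors and matrices indexed by 1, ..., N are those indexed by 'n.

   law i is the probability measure P_i under which the chain starts in i.
   kernel i j k is Q_ij(k) and sojourn i j k is f_ij(k).  The latter is part of the data since
   it is not determined by Q when p_ij = 0; its value at k = 0 is irrelevant. *)
record ('n, 'w) mrp =
  law :: "'n option \<Rightarrow> 'w measure"
  state :: "nat \<Rightarrow> 'w \<Rightarrow> 'n option"
  gap :: "nat \<Rightarrow> 'w \<Rightarrow> nat"
  kernel :: "'n option \<Rightarrow> 'n option \<Rightarrow> nat \<Rightarrow> real"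
  sojourn :: "'n option \<Rightarrow> 'n option \<Rightarrow> nat \<Rightarrow> real"

definition trans_prob :: "('n, 'w) mrp \<Rightarrow> 'n option \<Rightarrow> 'n option \<Rightarrow> real" where
  "trans_prob Z i j = (\<Sum>k. kernel Z i j (Suc k))"

definition markov_renewal :: "('n::finite, 'w) mrp \<Rightarrow> bool" where
  "markov_renewal Z \<longleftrightarrow>
     (\<forall>i j k. 0 \<le> kernel Z i j k) \<and>
     (\<forall>i j. kernel Z i j 0 = 0) \<and>
     (\<forall>i j. summable (kernel Z i j)) \<and>
     (\<forall>i. (\<Sum>j\<in>UNIV. trans_prob Z i j) = 1) \<and>
     (\<forall>i j. \<forall>k\<ge>1. 0 \<le> sojourn Z i j k) \<and>
     (\<forall>i j. (\<lambda>k. sojourn Z i j (Suc k)) sums 1) \<and>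
     (\<forall>i j. \<forall>k\<ge>1. kernel Z i j k = trans_prob Z i j * sojourn Z i j k) \<and>
     (\<forall>i. prob_space (law Z i) \<and>
       (\<forall>n. state Z n \<in> law Z i \<rightarrow>\<^sub>M count_space UNIV) \<and>
       (\<forall>n. gap Z n \<in> law Z i \<rightarrow>\<^sub>M count_space UNIV) \<and>
       (\<forall>n. \<forall>w\<in>space (law Z i). 1 \<le> gap Z n w) \<and>
       (AE w in law Z i. state Z 0 w = i) \<and>
       (\<forall>n x l j k.
          \<P>(w in law Z i. \<forall>m\<le>n. state Z m w = x m \<and> gap Z m w = l m) > 0 \<longrightarrow>
          \<P>(w in law Z i. state Z (Suc n) w = j \<and> gap Z (Suc n) w = k
              \<bar> \<forall>m\<le>n. state Z m w = x m \<and> gap Z m w = l m) = kernel Z (x n) j k))"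

definition renewal_time :: "('n, 'w) mrp \<Rightarrow> nat \<Rightarrow> 'w \<Rightarrow> nat" where
  "renewal_time Z n w = (\<Sum>m=1..n. gap Z m w)"

definition renewal_count :: "('n, 'w) mrp \<Rightarrow> nat \<Rightarrow> 'w \<Rightarrow> nat" where
  "renewal_count Z n w = Max {k. renewal_time Z k w \<le> n}"

definition semi_markov :: "('n, 'w) mrp \<Rightarrow> nat \<Rightarrow> 'w \<Rightarrow> 'n option" where
  "semi_markov Z n w = state Z (renewal_count Z n w) w"

(* nu_j and mu_j; the infimum of the empty set is infinity. *)
definition hit_step :: "('n, 'w) mrp \<Rightarrow> 'n option \<Rightarrow> 'w \<Rightarrow> enat" where
  "hit_step Z j w = Inf {enat n | n. 1 \<le> n \<and> state Z n w = j}"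

definition hit_time :: "('n, 'w) mrp \<Rightarrow> 'n option \<Rightarrow> 'w \<Rightarrow> enat" where
  "hit_time Z j w = (case hit_step Z j w of enat m \<Rightarrow> enat (renewal_time Z m w) | \<infinity> \<Rightarrow> \<infinity>)"

definition g_fun :: "('n, 'w) mrp \<Rightarrow> 'n option \<Rightarrow> 'n option \<Rightarrow> nat \<Rightarrow> real" where
  "g_fun Z i j n =
     \<P>(w in law Z i. hit_time Z j w = enat n \<and> hit_step Z None w > hit_step Z j w)"

definition g_tot :: "('n, 'w) mrp \<Rightarrow> 'n option \<Rightarrow> 'n option \<Rightarrow> real" where
  "g_tot Z i j = \<P>(w in law Z i. hit_step Z None w > hit_step Z j w)"

(* The power series below may diverge, so they take values in [0, infinity]. *)
definition phi :: "('n, 'w) mrp \<Rightarrow> 'n option \<Rightarrow> 'n option \<Rightarrow> real \<Rightarrow> ennreal" where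
  "phi Z i j \<rho> = (\<Sum>n. ennreal (exp (\<rho> * real n) * g_fun Z i j n))"

definition p_mom :: "('n, 'w) mrp \<Rightarrow> 'n option \<Rightarrow> 'n option \<Rightarrow> real \<Rightarrow> nat \<Rightarrow> ennreal" where
  "p_mom Z i j \<rho> r = (\<Sum>n. ennreal (real n ^ r * exp (\<rho> * real n) * kernel Z i j n))"

definition omega ::
  "('n, 'w) mrp \<Rightarrow> 'n option \<Rightarrow> 'n option \<Rightarrow> 'n option \<Rightarrow> real \<Rightarrow> nat \<Rightarrow> ennreal" where
  "omega Z i j s \<rho> r =
     (\<Sum>n. ennreal (real n ^ r * exp (\<rho> * real n) *
        \<P>(w in law Z i. semi_markov Z n w = s \<and> min (hit_time Z None w) (hit_time Z j w) > enat n)))"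

definition cond_A :: "(real \<Rightarrow> ('n, 'w) mrp) \<Rightarrow> bool" where
  "cond_A Z \<longleftrightarrow>
     (\<forall>i j. ((\<lambda>\<epsilon>. trans_prob (Z \<epsilon>) (Some i) j) \<longlongrightarrow> trans_prob (Z 0) (Some i) j) (at_right 0)) \<and>
     (\<forall>i j. \<forall>n\<ge>1. ((\<lambda>\<epsilon>. sojourn (Z \<epsilon>) (Some i) j n) \<longlongrightarrow> sojourn (Z 0) (Some i) j n) (at_right 0))"

definition cond_B :: "(real \<Rightarrow> ('n, 'w) mrp) \<Rightarrow> bool" where
  "cond_B Z \<longleftrightarrow> (\<forall>i j. g_tot (Z 0) (Some i) (Some j) > 0)"

(* The limes superior over 0 <= epsilon -> 0 includes epsilon = 0. *)
definition cond_C :: "(real \<Rightarrow> ('n, 'w) mrp) \<Rightarrow> real \<Rightarrow> bool" where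
  "cond_C Z \<beta> \<longleftrightarrow> \<beta> > 0 \<and>
     (\<forall>i j. Limsup (inf (nhds 0) (principal {0..})) (\<lambda>\<epsilon>. p_mom (Z \<epsilon>) (Some i) j \<beta> 0) < \<infinity>) \<and>
     (\<exists>i \<beta>'. \<beta>' \<le> \<beta> \<and> 1 < phi (Z 0) (Some i) (Some i) \<beta>' \<and> phi (Z 0) (Some i) (Some i) \<beta>' < \<infinity>)"

definition delta_param :: "(real \<Rightarrow> ('n, 'w) mrp) \<Rightarrow> real \<Rightarrow> real \<Rightarrow> bool" where
  "delta_param Z \<beta> \<delta> \<longleftrightarrow> 0 < \<delta> \<and> \<delta> \<le> \<beta> \<and>
     (\<forall>\<rho>\<le>\<delta>. \<forall>k j.
        ((\<lambda>\<epsilon>. phi (Z \<epsilon>) (Some k) (Some j) \<rho>) \<longlongrightarrow> phi (Z 0) (Some k) (Some j) \<rho>) (at_right 0) \<and>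
        phi (Z 0) (Some k) (Some j) \<rho> < \<infinity>) \<and>
     (\<forall>\<rho>\<le>\<delta>. \<forall>k j s.
        ((\<lambda>\<epsilon>. omega (Z \<epsilon>) (Some k) (Some j) (Some s) \<rho> 0)
           \<longlongrightarrow> omega (Z 0) (Some k) (Some j) (Some s) \<rho> 0) (at_right 0) \<and>
        omega (Z 0) (Some k) (Some j) (Some s) \<rho> 0 < \<infinity>) \<and>
     (\<forall>j. 1 < phi (Z 0) (Some j) (Some j) \<delta> \<and> phi (Z 0) (Some j) (Some j) \<delta> < \<infinity>) \<and>
     (\<exists>root :: real \<Rightarrow> real.
        (\<exists>e>0. \<forall>\<epsilon>. 0 \<le> \<epsilon> \<and> \<epsilon> < e \<longrightarrow>
           (\<forall>i. {x. 0 \<le> x \<and> phi (Z \<epsilon>) (Some i) (Some i) x = 1} = {root \<epsilon>})) \<and>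
        (root \<longlongrightarrow> root 0) (at_right 0) \<and> root 0 < \<delta>)"

(* F(eps) = c 0 + c 1 eps + ... + c m eps^m + o(eps^m) with c 0 = F(0) finite.  Since F may
   take the value infinity, finiteness of F(eps) for small eps is part of the expansion. *)
definition expands :: "(real \<Rightarrow> ennreal) \<Rightarrow> (nat \<Rightarrow> real) \<Rightarrow> nat \<Rightarrow> bool" where
  "expands F c m \<longleftrightarrow>
     F 0 < \<infinity> \<and> c 0 = enn2real (F 0) \<and>
     (\<forall>\<^sub>F \<epsilon> in at_right 0. F \<epsilon> < \<infinity>) \<and>
     (\<lambda>\<epsilon>. enn2real (F \<epsilon>) - (\<Sum>n=0..m. c n * \<epsilon> ^ n)) \<in> o[at_right 0](\<lambda>\<epsilon>. \<epsilon> ^ m)"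

definition expands_vec :: "(real \<Rightarrow> 'n \<Rightarrow> ennreal) \<Rightarrow> (nat \<Rightarrow> real ^ 'n::finite) \<Rightarrow> nat \<Rightarrow> bool" where
  "expands_vec F c m \<longleftrightarrow> (\<forall>i. expands (\<lambda>\<epsilon>. F \<epsilon> i) (\<lambda>n. c n $ i) m)"

(* For a fixed rho, a i j r n stands for the coefficient p_ij[rho, r, n], i nonzero. *)
definition cond_P ::
  "(real \<Rightarrow> ('n, 'w) mrp) \<Rightarrow> real \<Rightarrow> nat \<Rightarrow> ('n \<Rightarrow> 'n option \<Rightarrow> nat \<Rightarrow> nat \<Rightarrow> real) \<Rightarrow> bool" where
  "cond_P Z \<rho> k a \<longleftrightarrow>
     (\<forall>r\<le>k. \<forall>i j. expands (\<lambda>\<epsilon>. p_mom (Z \<epsilon>) (Some i) j \<rho> r) (a i j r) (k - r))"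

definition P_mat :: "('n::finite, 'w) mrp \<Rightarrow> real \<Rightarrow> 'n \<Rightarrow> real ^ 'n ^ 'n" where
  "P_mat Z \<rho> j = (\<chi> i l. if l = j then 0 else enn2real (p_mom Z (Some i) (Some l) \<rho> 0))"

definition P_coeff ::
  "('n::finite \<Rightarrow> 'n option \<Rightarrow> nat \<Rightarrow> nat \<Rightarrow> real) \<Rightarrow> 'n \<Rightarrow> nat \<Rightarrow> nat \<Rightarrow> real ^ 'n ^ 'n" where
  "P_coeff a j r n = (\<chi> i l. if l = j then 0 else a i (Some l) r n)"

fun U_coeff ::
  "(real \<Rightarrow> ('n::finite, 'w) mrp) \<Rightarrow> ('n \<Rightarrow> 'n option \<Rightarrow> nat \<Rightarrow> nat \<Rightarrow> real) \<Rightarrow> real \<Rightarrow> 'n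
    \<Rightarrow> nat \<Rightarrow> real ^ 'n ^ 'n" where
  "U_coeff Z a \<rho> j 0 = matrix_inv (mat 1 - P_mat (Z 0) \<rho> j)"
| "U_coeff Z a \<rho> j (Suc n) =
     matrix_inv (mat 1 - P_mat (Z 0) \<rho> j) **
       (\<Sum>q=1..Suc n. P_coeff a j 0 q ** U_coeff Z a \<rho> j (Suc n - q))"

definition psi_coeff ::
  "('n::finite \<Rightarrow> 'n option \<Rightarrow> nat \<Rightarrow> nat \<Rightarrow> real) \<Rightarrow> 'n \<Rightarrow> nat \<Rightarrow> nat \<Rightarrow> real" where
  "psi_coeff a i r n = (\<Sum>j\<in>UNIV. a i j r n)"

(* Coefficients of the expansion of the r-th derivative at rho of
   (E_i exp(rho kappa_1) - 1) / (exp rho - 1), continued by E_i kappa_1 at rho = 0.  They follow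
   from differentiating (exp rho - 1) * phi_i(rho) = E_i exp(rho kappa_1) - 1 r times if rho is
   nonzero, and r + 1 times if rho = 0. *)
fun varphi_coeff ::
  "('n::finite \<Rightarrow> 'n option \<Rightarrow> nat \<Rightarrow> nat \<Rightarrow> real) \<Rightarrow> real \<Rightarrow> 'n \<Rightarrow> nat \<Rightarrow> nat \<Rightarrow> real" where
  "varphi_coeff a \<rho> i r n =
     (if \<rho> = 0 then
        1 / real (r + 1) *
          (psi_coeff a i (r + 1) n - (\<Sum>m<r. real ((r + 1) choose m) * varphi_coeff a \<rho> i m n))
      else if r = 0 \<and> n = 0 then (psi_coeff a i 0 0 - 1) / (exp \<rho> - 1)
      else
        1 / (exp \<rho> - 1) *
          (psi_coeff a i r n - exp \<rho> * (\<Sum>m<r. real (r choose m) * varphi_coeff a \<rho> i m n)))"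

declare varphi_coeff.simps [simp del]

definition varphi_hat ::
  "('n::finite \<Rightarrow> 'n option \<Rightarrow> nat \<Rightarrow> nat \<Rightarrow> real) \<Rightarrow> real \<Rightarrow> 'n \<Rightarrow> nat \<Rightarrow> nat \<Rightarrow> real ^ 'n" where
  "varphi_hat a \<rho> s r n = (\<chi> i. if i = s then varphi_coeff a \<rho> i r n else 0)"

(* theta_coeff is only used for r >= 1. *)
fun omega_coeff theta_coeff ::
  "(real \<Rightarrow> ('n::finite, 'w) mrp) \<Rightarrow> ('n \<Rightarrow> 'n option \<Rightarrow> nat \<Rightarrow> nat \<Rightarrow> real) \<Rightarrow> real \<Rightarrow> 'n \<Rightarrow> 'n
    \<Rightarrow> nat \<Rightarrow> nat \<Rightarrow> real ^ 'n" where
  "omega_coeff Z a \<rho> j s r n =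
     (if n = 0 then \<chi> i. enn2real (omega (Z 0) (Some i) (Some j) (Some s) \<rho> r)
      else if r = 0 then \<Sum>q=0..n. U_coeff Z a \<rho> j q *v varphi_hat a \<rho> s 0 (n - q)
      else \<Sum>q=0..n. U_coeff Z a \<rho> j q *v theta_coeff Z a \<rho> j s r (n - q))"
| "theta_coeff Z a \<rho> j s r t =
     varphi_hat a \<rho> s r t +
     (\<Sum>m=1..r. real (r choose m) *\<^sub>R
        (\<Sum>q=0..t. P_coeff a j m q *v omega_coeff Z a \<rho> j s (r - m) (t - q)))"

declare omega_coeff.simps [simp del] theta_coeff.simps [simp del]

end

theory Submission
  imports Defs "HOL-Computational_Algebra.Formal_Power_Series"
begin

text \<open>
Fix the target state \<open>j\<close> and write \<open>h\<^sub>i(n)\<close> for the probability, from state \<open>i\<close>, that the semi-Markov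
process is in \<open>s\<close> at time \<open>n\<close> and has hit neither \<open>0\<close> nor \<open>j\<close>. Either the first gap exceeds \<open>n\<close>, or the
process restarts at its first jump; hence the renewal equation (\<open>renewal_equation\<close>)

  \<open>h\<^sub>i(n) = [i = s] P\<^sub>s(\<kappa>\<^sub>1 > n) + \<Sum>\<^sub>l \<Sum>\<^sub>m Q\<^sub>i\<^sub>l(m) h\<^sub>l(n - m)\<close>,   \<open>l\<close> neither \<open>0\<close> nor \<open>j\<close>.

The Markov property constrains only the next step given a whole history, so the restart at the
first jump is not directly available. What it does give, after summation over histories
(\<open>prob_next_step\<close>), is a recursion at the last jump for the law of (state, time) along paths that
avoid a set of states (\<open>prob_taboo_path\<close>). Written with formal power series in the time variable this
recursion is a matrix power, so it can be unrolled from the first jump as well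
(\<open>taboo_fps_first_step\<close>).

Multiplying the renewal equation by \<open>n\<^sup>r e\<^bsup>\<rho>n\<^esup>\<close> and summing turns it into linear equations
(\<open>omega_system\<close>)

  \<open>(I - P(\<rho>)) \<omega>(\<rho>, r) = \<phi>(\<rho>, r) + \<Sum>\<^sub>m (r choose m) P(\<rho>, m) \<omega>(\<rho>, r - m)\<close>,   \<open>1 \<le> m \<le> r\<close>,

where \<open>\<phi>(\<rho>, r)\<close> has a single nonzero entry, the moment of \<open>P\<^sub>s(\<kappa>\<^sub>1 > n)\<close>. All series converge for
\<open>\<rho> < \<delta>\<close>, because \<open>\<omega>(\<delta>, 0)\<close> is finite and dominates the tails of the gaps. For \<open>r = 0\<close> the equations
for \<open>s = 1, ..., N\<close> say that the vectors \<open>\<omega>\<close>, each divided by its number \<open>\<phi>\<^sub>s \<ge> 1\<close>, are the columns of a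
right inverse of \<open>I - P(\<rho>)\<close>; so this matrix is invertible (\<open>resolvent_inverse\<close>), and its inverse
is continuous in \<open>\<epsilon>\<close> at \<open>0\<close> because \<open>\<omega>\<close> and \<open>\<phi>\<close> are.

It remains to expand. Expansions multiply by the Cauchy product (\<open>expansion_bilinear\<close>). The
resolvent identity \<open>V\<^sub>\<epsilon> = V\<^sub>0 + V\<^sub>0 (P\<^sub>\<epsilon> - P\<^sub>0) V\<^sub>\<epsilon>\<close> gains one order in \<open>\<epsilon>\<close> at each use and
so expands the inverse with the coefficients \<open>U\<close> (\<open>expansion_resolvent\<close>); summation by parts expands
\<open>\<phi>\<close> (\<open>expansion_tail_moment\<close>); and induction on \<open>r\<close> expands \<open>\<omega>(\<rho>, r)\<close> (\<open>expansion_omega_vec\<close>).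
\<close>

section \<open>Asymptotic expansions in normed spaces\<close>

text \<open>The clause \<open>f 0 = c 0\<close> makes the leading coefficient the unperturbed value. It is inherited by sums
and products, so the cases \<open>\<epsilon> = 0\<close> and \<open>\<epsilon> > 0\<close> of an identity are treated together.\<close>

definition expansion :: "(real \<Rightarrow> 'a::real_normed_vector) \<Rightarrow> (nat \<Rightarrow> 'a) \<Rightarrow> nat \<Rightarrow> bool" where
  "expansion f c m \<longleftrightarrow> f 0 = c 0 \<and>
     ((\<lambda>\<epsilon>. (f \<epsilon> - (\<Sum>n=0..m. \<epsilon> ^ n *\<^sub>R c n)) /\<^sub>R \<epsilon> ^ m) \<longlongrightarrow> 0) (at_right 0)"

lemma expansion_at_0: "expansion f c m \<Longrightarrow> f 0 = c 0"
  by (simp add: expansion_def)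

lemma expansion_cong:
  assumes "expansion f c m" "f 0 = g 0" "\<forall>\<^sub>F \<epsilon> in at_right 0. f \<epsilon> = g \<epsilon>" "\<And>n. n \<le> m \<Longrightarrow> c n = d n"
  shows "expansion g d m"
proof -
  have "(\<Sum>n=0..m. \<epsilon> ^ n *\<^sub>R c n) = (\<Sum>n=0..m. \<epsilon> ^ n *\<^sub>R d n)" for \<epsilon> :: real
    using assms(4) by (intro sum.cong) auto
  then have "((\<lambda>\<epsilon>. (f \<epsilon> - (\<Sum>n=0..m. \<epsilon> ^ n *\<^sub>R d n)) /\<^sub>R \<epsilon> ^ m) \<longlongrightarrow> 0) (at_right 0)"
    using assms(1) by (simp add: expansion_def)
  moreover have "\<forall>\<^sub>F \<epsilon> in at_right 0. (f \<epsilon> - (\<Sum>n=0..m. \<epsilon> ^ n *\<^sub>R d n)) /\<^sub>R \<epsilon> ^ m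
      = (g \<epsilon> - (\<Sum>n=0..m. \<epsilon> ^ n *\<^sub>R d n)) /\<^sub>R \<epsilon> ^ m"
    using assms(3) by eventually_elim simp
  ultimately show ?thesis
    using assms(1,2) assms(4)[of 0] by (simp add: expansion_def tendsto_cong)
qed

lemma expansion_0: "expansion f c 0 \<longleftrightarrow> f 0 = c 0 \<and> (f \<longlongrightarrow> c 0) (at_right 0)"
  by (simp add: expansion_def LIM_zero_iff)

text \<open>An expansion of order \<open>m + 1\<close> is an expansion of order \<open>m\<close> of the difference quotient. This allows
induction on the order in place of estimates of remainders. At \<open>\<epsilon> = 0\<close>, the difference quotient is
given the value that its own expansion prescribes.\<close>

lemma expansion_Suc:
  "expansion f c (Suc m) \<longleftrightarrow> f 0 = c 0 \<and>
     expansion (\<lambda>\<epsilon>. if \<epsilon> = 0 then c 1 else (f \<epsilon> - c 0) /\<^sub>R \<epsilon>) (\<lambda>n. c (Suc n)) m"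
proof -
  have "\<forall>\<^sub>F \<epsilon> in at_right 0. (f \<epsilon> - (\<Sum>n=0..Suc m. \<epsilon> ^ n *\<^sub>R c n)) /\<^sub>R \<epsilon> ^ Suc m
    = ((if \<epsilon> = 0 then c 1 else (f \<epsilon> - c 0) /\<^sub>R \<epsilon>) - (\<Sum>n=0..m. \<epsilon> ^ n *\<^sub>R c (Suc n))) /\<^sub>R \<epsilon> ^ m"
    using eventually_at_right_less[of "0::real"]
  proof eventually_elim
    case (elim \<epsilon>)
    have "(\<Sum>n=0..Suc m. \<epsilon> ^ n *\<^sub>R c n) = c 0 + \<epsilon> *\<^sub>R (\<Sum>n=0..m. \<epsilon> ^ n *\<^sub>R c (Suc n))"
      by (simp add: sum.atLeast0_atMost_Suc_shift scaleR_sum_right del: sum.cl_ivl_Suc)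
    then have "(f \<epsilon> - (\<Sum>n=0..Suc m. \<epsilon> ^ n *\<^sub>R c n)) /\<^sub>R \<epsilon> ^ Suc m
      = ((f \<epsilon> - c 0) - \<epsilon> *\<^sub>R (\<Sum>n=0..m. \<epsilon> ^ n *\<^sub>R c (Suc n))) /\<^sub>R \<epsilon> /\<^sub>R \<epsilon> ^ m"
      by (simp add: diff_diff_add mult.commute)
    also have "\<dots> = ((f \<epsilon> - c 0) /\<^sub>R \<epsilon> - (\<Sum>n=0..m. \<epsilon> ^ n *\<^sub>R c (Suc n))) /\<^sub>R \<epsilon> ^ m"
      using elim by (simp add: scaleR_diff_right)
    finally show ?case using elim by simp
  qed
  then show ?thesis unfolding expansion_def by (simp add: tendsto_cong)
qed

lemma expansion_SucI:
  assumes "f 0 = c 0" "\<forall>\<^sub>F \<epsilon> in at_right 0. f \<epsilon> = c 0 + \<epsilon> *\<^sub>R g \<epsilon>"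
    and g: "expansion g (\<lambda>n. c (Suc n)) m"
  shows "expansion f c (Suc m)"
  unfolding expansion_Suc
proof (intro conjI assms(1) expansion_cong[OF g])
  show "\<forall>\<^sub>F \<epsilon> in at_right 0. g \<epsilon> = (if \<epsilon> = 0 then c 1 else (f \<epsilon> - c 0) /\<^sub>R \<epsilon>)"
    using assms(2) eventually_at_right_less[of "0::real"] by eventually_elim simp
qed (use expansion_at_0[OF g] in auto)

lemma expansion_SucE:
  assumes "expansion f c (Suc m)"
  obtains g where "f 0 = c 0" "\<And>\<epsilon>. \<epsilon> > 0 \<Longrightarrow> f \<epsilon> = c 0 + \<epsilon> *\<^sub>R g \<epsilon>" "expansion g (\<lambda>n. c (Suc n)) m"
  by (rule that[of "\<lambda>\<epsilon>. if \<epsilon> = 0 then c 1 else (f \<epsilon> - c 0) /\<^sub>R \<epsilon>"])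
    (use assms in \<open>auto simp: expansion_Suc\<close>)

lemma expansion_Suc_imp: "expansion f c (Suc m) \<Longrightarrow> expansion f c m"
proof (induction m arbitrary: f c)
  case 0
  obtain g where g: "f 0 = c 0" "\<And>\<epsilon>. \<epsilon> > 0 \<Longrightarrow> f \<epsilon> = c 0 + \<epsilon> *\<^sub>R g \<epsilon>" "expansion g (\<lambda>n. c (Suc n)) 0"
    using expansion_SucE[OF 0] by blast
  have "((\<lambda>\<epsilon>. c 0 + \<epsilon> *\<^sub>R g \<epsilon>) \<longlongrightarrow> c 0 + 0 *\<^sub>R c (Suc 0)) (at_right 0)"
    using g(3) by (intro tendsto_intros) (simp add: expansion_0)
  moreover have "\<forall>\<^sub>F \<epsilon> in at_right 0. c 0 + \<epsilon> *\<^sub>R g \<epsilon> = f \<epsilon>"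
    using eventually_at_right_less[of "0::real"] by eventually_elim (simp add: g(2))
  ultimately show ?case using g(1) by (simp add: expansion_0 tendsto_cong)
next
  case (Suc m)
  then show ?case using expansion_Suc by blast
qed

lemma expansion_le: "expansion f c m \<Longrightarrow> m' \<le> m \<Longrightarrow> expansion f c m'"
  by (induction m) (auto simp: le_Suc_eq dest: expansion_Suc_imp)

lemma expansion_tendsto: "expansion f c m \<Longrightarrow> (f \<longlongrightarrow> c 0) (at_right 0)"
  using expansion_le[of f c m 0] by (simp add: expansion_0)

lemma expansion_const: "expansion (\<lambda>_. x) (\<lambda>n. if n = 0 then x else 0) m"
proof -
  have "(\<Sum>n=0..m. \<epsilon> ^ n *\<^sub>R (if n = 0 then x else 0)) = x" for \<epsilon> :: real
    by (simp add: if_distrib cong: if_cong)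
  then show ?thesis by (simp add: expansion_def)
qed

lemma expansion_add:
  assumes "expansion f c m" "expansion g d m"
  shows "expansion (\<lambda>\<epsilon>. f \<epsilon> + g \<epsilon>) (\<lambda>n. c n + d n) m"
proof -
  have "((\<lambda>\<epsilon>. (f \<epsilon> - (\<Sum>n=0..m. \<epsilon> ^ n *\<^sub>R c n)) /\<^sub>R \<epsilon> ^ m + (g \<epsilon> - (\<Sum>n=0..m. \<epsilon> ^ n *\<^sub>R d n)) /\<^sub>R \<epsilon> ^ m)
      \<longlongrightarrow> 0 + 0) (at_right 0)"
    using assms by (intro tendsto_add) (auto simp: expansion_def)
  also have "(\<lambda>\<epsilon>. (f \<epsilon> - (\<Sum>n=0..m. \<epsilon> ^ n *\<^sub>R c n)) /\<^sub>R \<epsilon> ^ m + (g \<epsilon> - (\<Sum>n=0..m. \<epsilon> ^ n *\<^sub>R d n)) /\<^sub>R \<epsilon> ^ m)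
      = (\<lambda>\<epsilon>. (f \<epsilon> + g \<epsilon> - (\<Sum>n=0..m. \<epsilon> ^ n *\<^sub>R (c n + d n))) /\<^sub>R \<epsilon> ^ m)"
    by (simp add: scaleR_add_right[symmetric] sum.distrib del: scaleR_add_right)
      (simp add: scaleR_add_right sum.distrib algebra_simps)
  finally show ?thesis using assms by (simp add: expansion_def)
qed

lemma expansion_bounded_linear:
  assumes L: "bounded_linear L" and f: "expansion f c m"
  shows "expansion (\<lambda>\<epsilon>. L (f \<epsilon>)) (\<lambda>n. L (c n)) m"
proof -
  interpret bounded_linear L by (rule L)
  have "((\<lambda>\<epsilon>. L ((f \<epsilon> - (\<Sum>n=0..m. \<epsilon> ^ n *\<^sub>R c n)) /\<^sub>R \<epsilon> ^ m)) \<longlongrightarrow> 0) (at_right 0)"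
    using f by (intro tendsto_zero) (simp add: expansion_def)
  then show ?thesis using f by (simp add: expansion_def scaleR diff sum)
qed

lemma expansion_sum:
  "finite A \<Longrightarrow> (\<And>x. x \<in> A \<Longrightarrow> expansion (f x) (c x) m) \<Longrightarrow>
    expansion (\<lambda>\<epsilon>. \<Sum>x\<in>A. f x \<epsilon>) (\<lambda>n. \<Sum>x\<in>A. c x n) m"
proof (induction A rule: finite_induct)
  case empty
  then show ?case using expansion_const[of 0 m] by simp
qed (auto intro: expansion_add)

text \<open>With \<open>f = c\<^sub>0 + \<epsilon> f'\<close> and \<open>g = d\<^sub>0 + \<epsilon> g'\<close>, the difference quotient of the product is
\<open>c\<^sub>0 g' + f' g\<close>; its first summand is linear in \<open>g'\<close>, and the induction hypothesis applies to
the second.\<close>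

lemma expansion_bilinear:
  assumes "bounded_bilinear pr"
  shows "expansion f c m \<Longrightarrow> expansion g d m \<Longrightarrow>
    expansion (\<lambda>\<epsilon>. pr (f \<epsilon>) (g \<epsilon>)) (\<lambda>n. \<Sum>q=0..n. pr (c q) (d (n - q))) m"
proof (induction m arbitrary: f c g d)
  interpret bounded_bilinear pr by fact
  case 0
  then show ?case by (auto simp: expansion_0 intro: tendsto)
next
  interpret bounded_bilinear pr by fact
  case (Suc m)
  obtain f' where f': "f 0 = c 0" "\<And>\<epsilon>. \<epsilon> > 0 \<Longrightarrow> f \<epsilon> = c 0 + \<epsilon> *\<^sub>R f' \<epsilon>" "expansion f' (\<lambda>n. c (Suc n)) m"
    using expansion_SucE[OF Suc.prems(1)] by blast
  obtain g' where g': "g 0 = d 0" "\<And>\<epsilon>. \<epsilon> > 0 \<Longrightarrow> g \<epsilon> = d 0 + \<epsilon> *\<^sub>R g' \<epsilon>" "expansion g' (\<lambda>n. d (Suc n)) m"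
    using expansion_SucE[OF Suc.prems(2)] by blast
  have "expansion (\<lambda>\<epsilon>. pr (c 0) (g' \<epsilon>) + pr (f' \<epsilon>) (g \<epsilon>))
      (\<lambda>n. pr (c 0) (d (Suc n)) + (\<Sum>q=0..n. pr (c (Suc q)) (d (n - q)))) m"
    by (intro expansion_add expansion_bounded_linear[OF bounded_linear_right] g' f' Suc.IH
        expansion_Suc_imp[OF Suc.prems(2)])
  also have "(\<lambda>n. pr (c 0) (d (Suc n)) + (\<Sum>q=0..n. pr (c (Suc q)) (d (n - q))))
      = (\<lambda>n. \<Sum>q=0..Suc n. pr (c q) (d (Suc n - q)))"
    by (simp add: sum.atLeast0_atMost_Suc_shift del: sum.cl_ivl_Suc)
  finally show ?case
  proof (rule expansion_SucI[rotated 2])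
    show "\<forall>\<^sub>F \<epsilon> in at_right 0. pr (f \<epsilon>) (g \<epsilon>) = (\<Sum>q=0..0. pr (c q) (d (0 - q)))
        + \<epsilon> *\<^sub>R (pr (c 0) (g' \<epsilon>) + pr (f' \<epsilon>) (g \<epsilon>))"
      using eventually_at_right_less[of "0::real"]
    proof eventually_elim
      case (elim \<epsilon>)
      have "pr (f \<epsilon>) (g \<epsilon>) = pr (c 0) (g \<epsilon>) + \<epsilon> *\<^sub>R pr (f' \<epsilon>) (g \<epsilon>)"
        by (simp add: f'(2)[OF elim] add_left scaleR_left)
      also have "pr (c 0) (g \<epsilon>) = pr (c 0) (d 0) + \<epsilon> *\<^sub>R pr (c 0) (g' \<epsilon>)"
        by (simp add: g'(2)[OF elim] add_right scaleR_right)
      finally show ?case by (simp add: scaleR_add_right)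
    qed
  qed (simp add: f' g')
qed

lemma expansion_vec_iff:
  "expansion f c m \<longleftrightarrow> (\<forall>i. expansion (\<lambda>\<epsilon>. f \<epsilon> $ i) (\<lambda>n. c n $ i) m)"
  for f :: "real \<Rightarrow> 'a::real_normed_vector ^ 'n::finite"
proof
  show "\<forall>i. expansion (\<lambda>\<epsilon>. f \<epsilon> $ i) (\<lambda>n. c n $ i) m" if "expansion f c m"
    using expansion_bounded_linear[OF bounded_linear_vec_nth that] by blast
  show "expansion f c m" if "\<forall>i. expansion (\<lambda>\<epsilon>. f \<epsilon> $ i) (\<lambda>n. c n $ i) m"
    using that unfolding expansion_def by (auto simp: vec_eq_iff intro!: vec_tendstoI)
qed

lemma expands_iff_expansion:
  "expands F c m \<longleftrightarrow> F 0 < \<infinity> \<and> (\<forall>\<^sub>F \<epsilon> in at_right 0. F \<epsilon> < \<infinity>) \<and> expansion (\<lambda>\<epsilon>. enn2real (F \<epsilon>)) c m"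
proof -
  let ?R = "\<lambda>\<epsilon>. enn2real (F \<epsilon>) - (\<Sum>n=0..m. c n * \<epsilon> ^ n)"
  have "?R \<in> o[at_right 0](\<lambda>\<epsilon>. \<epsilon> ^ m) \<longleftrightarrow> ((\<lambda>\<epsilon>. ?R \<epsilon> / \<epsilon> ^ m) \<longlongrightarrow> 0) (at_right 0)"
    using eventually_at_right_less[of "0::real"]
    by (auto intro!: smalloI_tendsto dest: smalloD_tendsto elim!: eventually_mono)
  then show ?thesis
    by (auto simp: expands_def expansion_def divide_inverse mult.commute)
qed

lemma expansion_cmult: "expansion f c m \<Longrightarrow> expansion (\<lambda>\<epsilon>. x * f \<epsilon>) (\<lambda>n. x * c n) m" for x :: real
  by (rule expansion_bounded_linear[OF bounded_linear_mult_right])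

lemma expansion_diff:
  assumes "expansion f c m" "expansion g d m"
  shows "expansion (\<lambda>\<epsilon>. f \<epsilon> - g \<epsilon>) (\<lambda>n. c n - d n) m"
  using expansion_add[OF assms(1) expansion_bounded_linear[OF bounded_linear_minus[OF bounded_linear_ident] assms(2)]]
  by simp

lemma expansion_if:
  assumes "b \<Longrightarrow> expansion f c m" "\<not> b \<Longrightarrow> expansion g d m"
  shows "expansion (\<lambda>\<epsilon>. if b then f \<epsilon> else g \<epsilon>) (\<lambda>n. if b then c n else d n) m"
  using assms by (cases b) simp_all

lemma expansion_zero: "expansion (\<lambda>_. 0) (\<lambda>_. 0) m"
  using expansion_const[of 0 m] by simp

section \<open>Matrices and the expansion of a resolvent\<close>

lemma matrix_inv_mult:
  assumes "invertible A"
  shows matrix_inv_mult_right: "A ** matrix_inv A = mat 1"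
    and matrix_inv_mult_left: "matrix_inv A ** A = mat 1"
  using someI_ex[OF assms[unfolded invertible_def]] by (simp_all add: matrix_inv_def)

lemma matrix_inv_unique_right:
  fixes A :: "'a::field ^ 'n::finite ^ 'n"
  assumes "A ** B = mat 1"
  shows "matrix_inv A = B"
proof -
  have "invertible A" using assms invertible_right_inverse by blast
  then have "matrix_inv A ** (A ** B) = B"
    by (simp add: matrix_mul_assoc matrix_inv_mult_left)
  then show ?thesis by (simp add: assms)
qed

lemma matrix_add_rdistrib: "(A + B) ** C = A ** C + B ** C"
  by (simp add: matrix_matrix_mult_def vec_eq_iff distrib_right sum.distrib)

lemma bounded_bilinear_matrix_mult:
  "bounded_bilinear (\<lambda>(A :: real ^ 'k::finite ^ 'm::finite) (B :: real ^ 'n::finite ^ 'k). A ** B)"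
  by (subst bilinear_conv_bounded_bilinear[symmetric])
    (auto simp: bilinear_def matrix_add_ldistrib matrix_add_rdistrib scalar_matrix_assoc[symmetric]
      matrix_scalar_ac intro!: linearI)

lemma bounded_bilinear_matrix_vector_mult:
  "bounded_bilinear (\<lambda>(A :: real ^ 'k::finite ^ 'm::finite) (x :: real ^ 'k). A *v x)"
  by (subst bilinear_conv_bounded_bilinear[symmetric])
    (auto simp: bilinear_def matrix_vector_right_distrib matrix_vector_mult_add_rdistrib
      matrix_vector_mult_scaleR scaleR_matrix_vector_assoc intro!: linearI)

text \<open>Since \<open>P\<^sub>\<epsilon> - P\<^sub>0 = \<epsilon> P'\<^sub>\<epsilon>\<close>, the resolvent identity reads \<open>V\<^sub>\<epsilon> = V\<^sub>0 + \<epsilon> V\<^sub>0 P'\<^sub>\<epsilon> V\<^sub>\<epsilon>\<close>. Hence an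
expansion of \<open>V\<close> of order \<open>m\<close> yields one of order \<open>m + 1\<close>, and continuity of \<open>V\<close> at \<open>0\<close> is the
expansion of order \<open>0\<close>.\<close>

lemma expansion_resolvent:
  fixes P :: "real \<Rightarrow> real ^ 'n::finite ^ 'n"
  defines "V \<equiv> \<lambda>\<epsilon>. matrix_inv (mat 1 - P \<epsilon>)"
  assumes inv0: "invertible (mat 1 - P 0)" and inv: "\<forall>\<^sub>F \<epsilon> in at_right 0. invertible (mat 1 - P \<epsilon>)"
    and lim: "(V \<longlongrightarrow> V 0) (at_right 0)"
    and u0: "u 0 = V 0"
    and uSuc: "\<And>n. u (Suc n) = V 0 ** (\<Sum>q=1..Suc n. p q ** u (Suc n - q))"
  shows "expansion P p m \<Longrightarrow> expansion V u m"
proof (induction m)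
  case 0
  show ?case using lim u0 by (simp add: expansion_0)
next
  case (Suc m)
  obtain P' where P': "P 0 = p 0" "\<And>\<epsilon>. \<epsilon> > 0 \<Longrightarrow> P \<epsilon> = p 0 + \<epsilon> *\<^sub>R P' \<epsilon>" "expansion P' (\<lambda>n. p (Suc n)) m"
    using expansion_SucE[OF Suc.prems] by blast
  have V: "expansion V u m" using Suc expansion_Suc_imp by blast
  have "expansion (\<lambda>\<epsilon>. V 0 ** (P' \<epsilon> ** V \<epsilon>)) (\<lambda>n. V 0 ** (\<Sum>q=0..n. p (Suc q) ** u (n - q))) m"
    by (intro expansion_bounded_linear[OF bounded_bilinear.bounded_linear_right[OF bounded_bilinear_matrix_mult]]
        expansion_bilinear[OF bounded_bilinear_matrix_mult] P' V)
  also have "(\<lambda>n. V 0 ** (\<Sum>q=0..n. p (Suc q) ** u (n - q))) = (\<lambda>n. u (Suc n))"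
    unfolding uSuc One_nat_def sum.shift_bounds_cl_Suc_ivl by simp
  finally show ?case
  proof (rule expansion_SucI[rotated 2])
    show "\<forall>\<^sub>F \<epsilon> in at_right 0. V \<epsilon> = u 0 + \<epsilon> *\<^sub>R (V 0 ** (P' \<epsilon> ** V \<epsilon>))"
      using inv eventually_at_right_less[of "0::real"]
    proof eventually_elim
      case (elim \<epsilon>)
      have "V 0 ** ((mat 1 - P 0) ** V \<epsilon>) = V \<epsilon>"
        using matrix_inv_mult_left[OF inv0] by (simp add: V_def matrix_mul_assoc)
      moreover have "V 0 ** ((mat 1 - P \<epsilon>) ** V \<epsilon>) = V 0"
        using matrix_inv_mult_right[OF elim(1)] by (simp add: V_def)
      moreover have "mat 1 - P 0 = (mat 1 - P \<epsilon>) + \<epsilon> *\<^sub>R P' \<epsilon>"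
        using P'(1) P'(2)[OF elim(2)] by simp
      ultimately have "V \<epsilon> = V 0 + V 0 ** ((\<epsilon> *\<^sub>R P' \<epsilon>) ** V \<epsilon>)"
        by (metis matrix_add_ldistrib matrix_add_rdistrib)
      then show ?case using u0 by (simp add: scalar_matrix_assoc[symmetric] matrix_scalar_ac)
    qed
  qed (simp add: u0)
qed

section \<open>Paths that avoid a set of states\<close>

lemma markov_renewalD:
  assumes "markov_renewal Z"
  shows kernel_nonneg: "0 \<le> kernel Z i j k"
    and kernel_zero: "kernel Z i j 0 = 0"
    and kernel_summable: "summable (kernel Z i j)"
    and trans_prob_sum: "(\<Sum>j\<in>UNIV. trans_prob Z i j) = 1"
    and law_prob_space: "prob_space (law Z i)"
    and state_measurable: "state Z n \<in> law Z i \<rightarrow>\<^sub>M count_space UNIV"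
    and gap_measurable: "gap Z n \<in> law Z i \<rightarrow>\<^sub>M count_space UNIV"
    and gap_pos: "w \<in> space (law Z i) \<Longrightarrow> 1 \<le> gap Z n w"
    and initial_state: "AE w in law Z i. state Z 0 w = i"
    and markov_property:
      "\<P>(w in law Z i. \<forall>m\<le>n. state Z m w = x m \<and> gap Z m w = l m) > 0 \<Longrightarrow>
       \<P>(w in law Z i. state Z (Suc n) w = j \<and> gap Z (Suc n) w = k
          \<bar> \<forall>m\<le>n. state Z m w = x m \<and> gap Z m w = l m) = kernel Z (x n) j k"
  using assms by (simp_all add: markov_renewal_def)

text \<open>The event \<open>E\<close> is a disjoint union of countably many events that prescribe the history up to step
\<open>n\<close>. On each of them the conditional law of the next step is the kernel at the same state \<open>x\<close>, so
the common factor comes out of the sum. Histories include the initial gap, whose law is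
unspecified.\<close>

lemma prob_next_step:
  assumes Z: "markov_renewal Z"
    and det: "\<And>w w'. (\<And>m. m \<le> n \<Longrightarrow> state Z m w = state Z m w' \<and> gap Z m w = gap Z m w') \<Longrightarrow> E w = E w'"
    and last: "\<And>w. E w \<Longrightarrow> state Z n w = x"
  shows "Measurable.pred (law Z i) E" (is ?meas)
    and "\<P>(w in law Z i. E w \<and> state Z (Suc n) w = j \<and> gap Z (Suc n) w = k)
           = \<P>(w in law Z i. E w) * kernel Z x j k" (is ?step)
proof -
  interpret prob_space "law Z i" using law_prob_space[OF Z] .
  note [measurable] = state_measurable[OF Z] gap_measurable[OF Z]
  (* The history up to step n, with values in a countable type. *)
  define H where "H w = map (\<lambda>m. (state Z m w, gap Z m w)) [0..<Suc n]" for w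
  define S where "S = H ` Collect E"
  have H_eq: "H w = H w' \<longleftrightarrow> (\<forall>m\<le>n. state Z m w = state Z m w' \<and> gap Z m w = gap Z m w')" for w w'
    unfolding H_def by (auto simp: less_Suc_eq_le simp del: upt_Suc)
  have E_eq: "E w \<longleftrightarrow> H w \<in> S" for w
    unfolding S_def using H_eq det by blast
  have H_meas[measurable]: "H \<in> law Z i \<rightarrow>\<^sub>M count_space UNIV"
  proof (subst measurable_count_space_eq2_countable, safe)
    fix h :: "('a option \<times> nat) list"
    show "H -` {h} \<inter> space (law Z i) \<in> sets (law Z i)"
    proof (cases "h \<in> range H")
      case True
      then obtain v where "h = H v" by auto
      then have "H -` {h} \<inter> space (law Z i)
        = {w\<in>space (law Z i). \<forall>m\<le>n. state Z m w = state Z m v \<and> gap Z m w = gap Z m v}"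
        using H_eq by auto
      then show ?thesis by simp
    next
      case False
      then have "H -` {h} \<inter> space (law Z i) = {}" by auto
      then show ?thesis by (metis sets.empty_sets)
    qed
  qed auto
  have E_meas[measurable]: "Measurable.pred (law Z i) E"
    unfolding E_eq[abs_def] by measurable
  show ?meas by (rule E_meas)
  let ?F = "\<lambda>w. state Z (Suc n) w = j \<and> gap Z (Suc n) w = k"
  have hist: "\<P>(w in law Z i. H w = h \<and> ?F w) = \<P>(w in law Z i. H w = h) * kernel Z x j k"
    if h: "h \<in> S" for h
  proof -
    from h obtain v where v: "E v" "h = H v" unfolding S_def by auto
    let ?Q = "\<lambda>w. \<forall>m\<le>n. state Z m w = state Z m v \<and> gap Z m w = gap Z m v"
    have Q: "H w = h \<longleftrightarrow> ?Q w" for w using H_eq v by auto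
    show ?thesis
    proof (cases "\<P>(w in law Z i. ?Q w) = 0")
      case True
      have "\<P>(w in law Z i. H w = h \<and> ?F w) \<le> \<P>(w in law Z i. ?Q w)"
        by (rule finite_measure_mono) (auto simp: Q)
      then show ?thesis using True unfolding Q by (simp add: measure_le_0_iff)
    next
      case False
      then have "\<P>(w in law Z i. ?Q w) > 0" by (simp add: zero_less_measure_iff)
      from markov_property[OF Z this, of j k] last[OF v(1)] False
      show ?thesis unfolding Q cond_prob_def by (simp add: field_simps conj_commute)
    qed
  qed
  have split: "emeasure (law Z i) {w\<in>space (law Z i). E w \<and> R w}
      = (\<integral>\<^sup>+ h. emeasure (law Z i) {w\<in>space (law Z i). H w = h \<and> R w} \<partial>count_space S)"
    if [measurable]: "Measurable.pred (law Z i) R" for R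
  proof -
    have E_R: "{w\<in>space (law Z i). E w \<and> R w} = (\<Union>h\<in>S. {w\<in>space (law Z i). H w = h \<and> R w})"
      by (auto simp: E_eq)
    show ?thesis
      unfolding E_R by (rule emeasure_UN_countable) (auto simp: disjoint_family_on_def)
  qed
  have "emeasure (law Z i) {w\<in>space (law Z i). E w \<and> ?F w}
      = (\<integral>\<^sup>+ h. emeasure (law Z i) {w\<in>space (law Z i). H w = h} * ennreal (kernel Z x j k) \<partial>count_space S)"
    by (subst split, measurable)
      (auto intro!: nn_integral_cong simp: emeasure_eq_measure hist ennreal_mult kernel_nonneg[OF Z])
  also have "\<dots> = emeasure (law Z i) {w\<in>space (law Z i). E w} * ennreal (kernel Z x j k)"
    using split[of "\<lambda>_. True"] by (simp add: nn_integral_multc)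
  finally show ?step
    by (simp add: emeasure_eq_measure ennreal_mult'[symmetric] kernel_nonneg[OF Z] zero_le_mult_iff)
qed

text \<open>The coefficient at \<open>t\<close> is the probability, from \<open>i\<close>, of being in \<open>s\<close> after \<open>c\<close> jumps at time \<open>t\<close>
with no jump into \<open>B\<close>. A power series in the time variable makes convolution a product.\<close>

fun taboo_fps :: "('n::finite, 'w) mrp \<Rightarrow> 'n option set \<Rightarrow> nat \<Rightarrow> 'n option \<Rightarrow> 'n option \<Rightarrow> real fps" where
  "taboo_fps Z B 0 i s = (if s = i then 1 else 0)"
| "taboo_fps Z B (Suc c) i s =
     (if s \<in> B then 0 else \<Sum>l\<in>UNIV. taboo_fps Z B c i l * Abs_fps (kernel Z l s))"

definition taboo_path :: "('n, 'w) mrp \<Rightarrow> 'n option set \<Rightarrow> nat \<Rightarrow> 'n option \<Rightarrow> nat \<Rightarrow> 'w \<Rightarrow> bool" where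
  "taboo_path Z B c s t w \<longleftrightarrow>
     state Z c w = s \<and> renewal_time Z c w = t \<and> (\<forall>m\<in>{1..c}. state Z m w \<notin> B)"

lemma taboo_path_next:
  assumes "markov_renewal Z"
  shows "Measurable.pred (law Z i) (taboo_path Z B c s t)"
    and "\<P>(w in law Z i. taboo_path Z B c s t w \<and> state Z (Suc c) w = j \<and> gap Z (Suc c) w = k)
           = \<P>(w in law Z i. taboo_path Z B c s t w) * kernel Z s j k"
proof -
  have det: "taboo_path Z B c s t w = taboo_path Z B c s t w'"
    if "\<And>m. m \<le> c \<Longrightarrow> state Z m w = state Z m w' \<and> gap Z m w = gap Z m w'" for w w'
  proof -
    have "renewal_time Z c w = renewal_time Z c w'"
      unfolding renewal_time_def using that by (intro sum.cong) auto
    then show ?thesis using that unfolding taboo_path_def by auto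
  qed
  have last: "state Z c w = s" if "taboo_path Z B c s t w" for w
    using that by (simp add: taboo_path_def)
  show "Measurable.pred (law Z i) (taboo_path Z B c s t)"
    by (rule prob_next_step(1)[OF assms det last])
  show "\<P>(w in law Z i. taboo_path Z B c s t w \<and> state Z (Suc c) w = j \<and> gap Z (Suc c) w = k)
           = \<P>(w in law Z i. taboo_path Z B c s t w) * kernel Z s j k"
    by (rule prob_next_step(2)[OF assms det last])
qed

lemma renewal_time_0: "renewal_time Z 0 w = 0"
  by (simp add: renewal_time_def)

lemma renewal_time_Suc: "renewal_time Z (Suc c) w = renewal_time Z c w + gap Z (Suc c) w"
  by (simp add: renewal_time_def)

text \<open>Decompose according to the state and the time before the last jump.\<close>

lemma prob_taboo_path:
  assumes Z: "markov_renewal Z"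
  shows "\<P>(w in law Z i. taboo_path Z B c s t w) = fps_nth (taboo_fps Z B c i s) t"
proof (induction c arbitrary: s t)
  case 0
  interpret prob_space "law Z i" using law_prob_space[OF Z] .
  note [measurable] = state_measurable[OF Z]
  have "\<P>(w in law Z i. taboo_path Z B 0 s t w) = \<P>(w in law Z i. s = i \<and> t = 0)"
    using initial_state[OF Z, of i]
    by (intro measure_eq_AE) (auto simp: taboo_path_def renewal_time_0)
  then show ?case by (auto simp: prob_space)
next
  case (Suc c)
  interpret prob_space "law Z i" using law_prob_space[OF Z] .
  note [measurable] = state_measurable[OF Z] gap_measurable[OF Z] taboo_path_next(1)[OF Z]
  show ?case
  proof (cases "s \<in> B")
    case True
    then have "\<not> taboo_path Z B (Suc c) s t w" for w by (auto simp: taboo_path_def)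
    then show ?thesis using True by simp
  next
    case False
    (* The paths that are in l at time u before their last jump. *)
    define A where "A = (\<lambda>(l, u). {w \<in> space (law Z i). taboo_path Z B c l u w
      \<and> state Z (Suc c) w = s \<and> gap Z (Suc c) w = t - u})"
    have "{w \<in> space (law Z i). taboo_path Z B (Suc c) s t w} = (\<Union>x\<in>UNIV \<times> {0..t}. A x)"
      using False by (auto simp: taboo_path_def A_def renewal_time_Suc le_Suc_eq)
    then have "\<P>(w in law Z i. taboo_path Z B (Suc c) s t w) = prob (\<Union>x\<in>UNIV \<times> {0..t}. A x)"
      by simp
    also have "\<dots> = (\<Sum>x\<in>UNIV \<times> {0..t}. prob (A x))"
    proof (intro finite_measure_finite_Union)
      show "disjoint_family_on A (UNIV \<times> {0..t})"
        by (auto simp: A_def disjoint_family_on_def taboo_path_def)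
    qed (auto simp: A_def)
    also have "\<dots> = (\<Sum>l\<in>UNIV. \<Sum>u=0..t. prob (A (l, u)))"
      by (simp add: sum.cartesian_product)
    also have "\<dots> = (\<Sum>l\<in>UNIV. \<Sum>u=0..t. fps_nth (taboo_fps Z B c i l) u * kernel Z l s (t - u))"
      by (simp add: A_def taboo_path_next(2)[OF Z] Suc.IH)
    also have "\<dots> = fps_nth (taboo_fps Z B (Suc c) i s) t"
      using False by (simp add: fps_sum_nth fps_mult_nth)
    finally show ?thesis .
  qed
qed

text \<open>The series are the entries of the \<open>c\<close>-th power of the kernel matrix whose columns in \<open>B\<close> are set
to zero, and a power may be unrolled from either end.\<close>

lemma taboo_fps_first_step:
  "taboo_fps Z B (Suc c) i s = (\<Sum>l\<in>-B. Abs_fps (kernel Z i l) * taboo_fps Z B c l s)"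
proof (induction c arbitrary: s)
  case 0
  then show ?case by (simp add: if_distrib if_distribR cong: if_cong)
next
  case (Suc c)
  have "taboo_fps Z B (Suc (Suc c)) i s = (if s \<in> B then 0 else
    \<Sum>m\<in>UNIV. (\<Sum>l\<in>-B. Abs_fps (kernel Z i l) * taboo_fps Z B c l m) * Abs_fps (kernel Z m s))"
    by (subst taboo_fps.simps(2), simp only: Suc.IH)
  also have "\<dots> = (\<Sum>l\<in>-B. Abs_fps (kernel Z i l) * taboo_fps Z B (Suc c) l s)"
    by (simp add: sum_distrib_left sum_distrib_right mult.assoc)  (intro impI sum.swap)
  finally show ?case .
qed

text \<open>Each gap takes at least one unit of time, so only finitely many jumps occur by a given time.\<close>

lemma taboo_fps_nth_eq_0:
  assumes Z: "markov_renewal Z" and "t < c"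
  shows "fps_nth (taboo_fps Z B c i s) t = 0"
proof -
  interpret prob_space "law Z i" using law_prob_space[OF Z] .
  have "c \<le> renewal_time Z c w" if "w \<in> space (law Z i)" for w
    using sum_mono[of "{1..c}" "\<lambda>_. 1" "\<lambda>m. gap Z m w"] gap_pos[OF Z that]
    by (simp add: renewal_time_def)
  then have "{w \<in> space (law Z i). taboo_path Z B c s t w} = {}"
    using assms(2) by (fastforce simp: taboo_path_def)
  then show ?thesis
    by (metis measure_empty prob_taboo_path[OF Z])
qed

text \<open>The probability \<open>P\<^sub>i(\<kappa>\<^sub>1 > n)\<close>, expressed by the kernel.\<close>

definition gap_tail :: "('n::finite, 'w) mrp \<Rightarrow> 'n option \<Rightarrow> nat \<Rightarrow> real" where
  "gap_tail Z i n = 1 - (\<Sum>k\<le>n. \<Sum>j\<in>UNIV. kernel Z i j k)"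

lemma gap_tail_0: "markov_renewal Z \<Longrightarrow> gap_tail Z i 0 = 1"
  by (simp add: gap_tail_def kernel_zero)

lemma gap_tail_Suc: "gap_tail Z i n = gap_tail Z i (Suc n) + (\<Sum>j\<in>UNIV. kernel Z i j (Suc n))"
  by (simp add: gap_tail_def)

lemma gap_tail_nonneg:
  assumes Z: "markov_renewal Z"
  shows "0 \<le> gap_tail Z i n"
proof -
  have le: "(\<Sum>k\<le>n. kernel Z i j k) \<le> trans_prob Z i j" for j
  proof -
    have "(\<Sum>k\<le>n. kernel Z i j k) \<le> (\<Sum>k. kernel Z i j k)"
      by (intro sum_le_suminf kernel_summable[OF Z]) (auto simp: kernel_nonneg[OF Z])
    also have "\<dots> = trans_prob Z i j"
      using suminf_split_head[OF kernel_summable[OF Z]]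
      by (simp add: trans_prob_def kernel_zero[OF Z])
    finally show ?thesis .
  qed
  have "(\<Sum>k\<le>n. \<Sum>j\<in>UNIV. kernel Z i j k) = (\<Sum>j\<in>UNIV. \<Sum>k\<le>n. kernel Z i j k)"
    by (rule sum.swap)
  also have "\<dots> \<le> (\<Sum>j\<in>UNIV. trans_prob Z i j)"
    by (intro sum_mono le)
  finally show ?thesis by (simp add: gap_tail_def trans_prob_sum[OF Z])
qed

text \<open>The complement within the path event is a finite union over the next state and the value of the
next gap.\<close>

lemma prob_taboo_path_gap:
  assumes Z: "markov_renewal Z"
  shows "\<P>(w in law Z i. taboo_path Z B c s t w \<and> d < gap Z (Suc c) w)
           = fps_nth (taboo_fps Z B c i s) t * gap_tail Z s d"
proof -
  interpret prob_space "law Z i" using law_prob_space[OF Z] .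
  note [measurable] = state_measurable[OF Z] gap_measurable[OF Z] taboo_path_next(1)[OF Z]
  define A where "A = (\<lambda>(k, j). {w \<in> space (law Z i). taboo_path Z B c s t w
    \<and> state Z (Suc c) w = j \<and> gap Z (Suc c) w = k})"
  define U where "U = (\<Union>x\<in>{..d} \<times> UNIV. A x)"
  have U: "U = {w \<in> space (law Z i). taboo_path Z B c s t w \<and> gap Z (Suc c) w \<le> d}"
    by (auto simp: U_def A_def)
  have "prob U = (\<Sum>x\<in>{..d} \<times> UNIV. prob (A x))"
    unfolding U_def
    by (intro finite_measure_finite_Union) (auto simp: A_def disjoint_family_on_def)
  also have "\<dots> = (\<Sum>k\<le>d. \<Sum>j\<in>UNIV. prob (A (k, j)))"
    by (simp add: sum.cartesian_product)
  also have "\<dots> = (\<Sum>k\<le>d. \<Sum>j\<in>UNIV. fps_nth (taboo_fps Z B c i s) t * kernel Z s j k)"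
    by (simp add: A_def taboo_path_next(2)[OF Z] prob_taboo_path[OF Z])
  finally have U': "prob U = \<dots>" .
  have "\<P>(w in law Z i. taboo_path Z B c s t w)
      = prob (U \<union> {w \<in> space (law Z i). taboo_path Z B c s t w \<and> d < gap Z (Suc c) w})"
    by (rule arg_cong[where f=prob]) (auto simp: U)
  also have "\<dots> = prob U + \<P>(w in law Z i. taboo_path Z B c s t w \<and> d < gap Z (Suc c) w)"
    by (rule finite_measure_Union) (auto simp: U)
  finally show ?thesis
    by (simp add: U' prob_taboo_path[OF Z] gap_tail_def algebra_simps sum_distrib_left)
qed

section \<open>The renewal equation\<close>

definition occupation_prob :: "('n, 'w) mrp \<Rightarrow> 'n option \<Rightarrow> 'n option \<Rightarrow> 'n option \<Rightarrow> nat \<Rightarrow> real" where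
  "occupation_prob Z i j s n =
     \<P>(w in law Z i. semi_markov Z n w = s \<and> min (hit_time Z None w) (hit_time Z j w) > enat n)"

lemma renewal_count_unique:
  assumes pos: "\<And>m. 1 \<le> gap Z m w"
    and "renewal_time Z c w \<le> n" "n < renewal_time Z (Suc c) w"
  shows "{k. renewal_time Z k w \<le> n} = {..c}"
proof -
  have "strict_mono (\<lambda>k. renewal_time Z k w)"
    using pos by (intro strict_monoI_Suc) (simp add: renewal_time_Suc less_eq_Suc_le)
  then have mono: "renewal_time Z k w \<le> renewal_time Z m w \<longleftrightarrow> k \<le> m" for k m
    by (rule strict_mono_less_eq)
  show ?thesis
    using assms(2,3) mono by (auto simp: not_less_eq_eq[symmetric]) (meson leD le_trans not_less_eq_eq order.strict_trans1)+
qed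

text \<open>Gaps are positive, so the renewal times exceed every bound.\<close>

lemma renewal_count_exists:
  assumes pos: "\<And>m. 1 \<le> gap Z m w"
  obtains c where "renewal_time Z c w \<le> n" "n < renewal_time Z (Suc c) w"
proof -
  have "Suc n \<le> renewal_time Z (Suc n) w"
    using sum_mono[of "{1..Suc n}" "\<lambda>_. 1" "\<lambda>m. gap Z m w"] pos by (simp add: renewal_time_def)
  then have "\<exists>c. n < renewal_time Z c w" by (metis Suc_le_eq)
  then obtain c where c: "n < renewal_time Z c w" "\<And>m. m < c \<Longrightarrow> \<not> n < renewal_time Z m w"
    using exists_least_iff[of "\<lambda>c. n < renewal_time Z c w"] by auto
  then obtain c' where "c = Suc c'" by (cases c) (auto simp: renewal_time_0)
  with c that[of c'] show ?thesis by (auto simp: not_less)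
qed

text \<open>If finite, the hitting time is the time of a jump, and the jumps up to time \<open>n\<close> are the first \<open>c\<close> ones.\<close>

lemma hit_time_gt_iff:
  assumes pos: "\<And>m. 1 \<le> gap Z m w"
    and c: "renewal_time Z c w \<le> n" "n < renewal_time Z (Suc c) w"
  shows "enat n < hit_time Z j w \<longleftrightarrow> (\<forall>m\<in>{1..c}. state Z m w \<noteq> j)"
proof -
  have le_iff: "renewal_time Z k w \<le> n \<longleftrightarrow> k \<le> c" for k
    using renewal_count_unique[OF assms] by auto
  let ?S = "{enat n | n. 1 \<le> n \<and> state Z n w = j}"
  show ?thesis
  proof (cases "\<exists>m\<ge>1. state Z m w = j")
    case False
    then have "hit_step Z j w = \<infinity>" by (auto simp: hit_step_def Inf_enat_def)
    then show ?thesis using False by (auto simp: hit_time_def)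
  next
    case True
    define m where "m = (LEAST m. 1 \<le> m \<and> state Z m w = j)"
    have m: "1 \<le> m" "state Z m w = j" unfolding m_def using LeastI_ex[OF True[simplified Bex_def]] by auto
    have least: "m \<le> k" if "1 \<le> k" "state Z k w = j" for k
      unfolding m_def using that by (intro Least_le) auto
    have "hit_step Z j w = enat m"
      unfolding hit_step_def using m least
      by (intro antisym Inf_lower Inf_greatest) auto
    then have "enat n < hit_time Z j w \<longleftrightarrow> c < m"
      using le_iff[of m] by (simp add: hit_time_def not_le[symmetric])
    also have "\<dots> \<longleftrightarrow> (\<forall>m\<in>{1..c}. state Z m w \<noteq> j)"
      using m least by (force simp: not_le[symmetric])
    finally show ?thesis .
  qed
qed

text \<open>The event is split according to the number \<open>c\<close> of jumps up to time \<open>n\<close> and the time \<open>t\<close> of the last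
of them, which are determined by the trajectory.\<close>

lemma occupation_event_iff:
  assumes pos: "\<And>m. 1 \<le> gap Z m w"
  shows "semi_markov Z n w = s \<and> min (hit_time Z None w) (hit_time Z j w) > enat n \<longleftrightarrow>
    (\<exists>c\<le>n. \<exists>t\<le>n. taboo_path Z {None, j} c s t w \<and> n - t < gap Z (Suc c) w)" (is "?L \<longleftrightarrow> ?R")
proof -
  obtain c where c: "renewal_time Z c w \<le> n" "n < renewal_time Z (Suc c) w"
    using renewal_count_exists[OF pos] .
  have "renewal_count Z n w = c"
    unfolding renewal_count_def renewal_count_unique[OF pos c] by (intro Max_eqI) auto
  then have L: "?L \<longleftrightarrow> taboo_path Z {None, j} c s (renewal_time Z c w) w"
    using hit_time_gt_iff[OF pos c] by (auto simp: semi_markov_def taboo_path_def)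
  have "c \<le> renewal_time Z c w"
    using sum_mono[of "{1..c}" "\<lambda>_. 1" "\<lambda>m. gap Z m w"] pos by (simp add: renewal_time_def)
  then have "c \<le> n" using c by simp
  moreover have "n - renewal_time Z c w < gap Z (Suc c) w" using c by (simp add: renewal_time_Suc)
  ultimately have "?L \<Longrightarrow> ?R" using c L by blast
  moreover have "c' = c \<and> t = renewal_time Z c w"
    if "t \<le> n" "taboo_path Z {None, j} c' s t w" "n - t < gap Z (Suc c') w" for c' t
  proof -
    have "renewal_time Z c' w \<le> n" "n < renewal_time Z (Suc c') w" "t = renewal_time Z c' w"
      using that by (auto simp: taboo_path_def renewal_time_Suc)
    then have "{..c'} = {..c}" using renewal_count_unique[OF pos] c by metis
    then show ?thesis using \<open>t = _\<close> by simp
  qed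
  ultimately show ?thesis using L by blast
qed

lemma occupation_prob_eq_taboo:
  assumes Z: "markov_renewal Z"
  shows "occupation_prob Z i j s n
    = (\<Sum>c\<le>n. fps_nth (taboo_fps Z {None, j} c i s * Abs_fps (gap_tail Z s)) n)"
proof -
  interpret prob_space "law Z i" using law_prob_space[OF Z] .
  note [measurable] = gap_measurable[OF Z] taboo_path_next(1)[OF Z]
  define A where "A = (\<lambda>(c, t). {w \<in> space (law Z i). taboo_path Z {None, j} c s t w
    \<and> n - t < gap Z (Suc c) w})"
  have "{w \<in> space (law Z i). semi_markov Z n w = s \<and> min (hit_time Z None w) (hit_time Z j w) > enat n}
    = {w \<in> space (law Z i). \<exists>c\<le>n. \<exists>t\<le>n. taboo_path Z {None, j} c s t w \<and> n - t < gap Z (Suc c) w}"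
    using occupation_event_iff[OF gap_pos[OF Z, of _ i], of _ n s j] by (intro Collect_cong) blast
  also have "\<dots> = (\<Union>x\<in>{..n} \<times> {0..n}. A x)"
    by (fastforce simp: A_def)
  finally have "occupation_prob Z i j s n = prob (\<Union>x\<in>{..n} \<times> {0..n}. A x)"
    by (simp add: occupation_prob_def)
  also have "\<dots> = (\<Sum>x\<in>{..n} \<times> {0..n}. prob (A x))"
  proof (intro finite_measure_finite_Union)
    have "c = c' \<and> t = t'" if "w \<in> A (c, t)" "w \<in> A (c', t')" "t \<le> n" "t' \<le> n" for w c t c' t'
    proof -
      have pos: "1 \<le> gap Z m w" for m using that gap_pos[OF Z, of w i] by (auto simp: A_def)
      have "renewal_time Z c w \<le> n" "n < renewal_time Z (Suc c) w" "t = renewal_time Z c w"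
        "renewal_time Z c' w \<le> n" "n < renewal_time Z (Suc c') w" "t' = renewal_time Z c' w"
        using that by (auto simp: A_def taboo_path_def renewal_time_Suc)
      then show ?thesis using renewal_count_unique[of Z w, OF pos] by (metis atMost_eq_iff)
    qed
    then show "disjoint_family_on A ({..n} \<times> {0..n})"
      unfolding disjoint_family_on_def by fastforce
  qed (auto simp: A_def)
  also have "\<dots> = (\<Sum>c\<le>n. \<Sum>t=0..n. prob (A (c, t)))"
    by (simp add: sum.cartesian_product)
  also have "\<dots> = (\<Sum>c\<le>n. \<Sum>t=0..n. fps_nth (taboo_fps Z {None, j} c i s) t * gap_tail Z s (n - t))"
    by (simp add: A_def prob_taboo_path_gap[OF Z])
  finally show ?thesis by (simp add: fps_mult_nth)
qed

text \<open>Separate the paths without a jump from the others and unroll the latter at the first jump.\<close>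

lemma renewal_equation:
  assumes Z: "markov_renewal Z"
  shows "occupation_prob Z i j s n = (if i = s then gap_tail Z s n else 0)
    + (\<Sum>l\<in>-{None, j}. \<Sum>m\<le>n. kernel Z i l m * occupation_prob Z l j s (n - m))"
proof -
  define T where "T = Abs_fps (gap_tail Z s)"
  define B where "B = {None, j}"
  (* Terms with more than n jumps vanish, so the range of the sum over the number of jumps can be
     extended and does not depend on the remaining time n - m. *)
  have vanish: "fps_nth (taboo_fps Z B c l s * T) u = 0" if "u < c" for l c u
    unfolding fps_mult_nth using that by (intro sum.neutral) (auto simp: taboo_fps_nth_eq_0[OF Z])
  have long: "occupation_prob Z l j s u = (\<Sum>c<N. fps_nth (taboo_fps Z B c l s * T) u)"
    if "u < N" for l u N
    unfolding occupation_prob_eq_taboo[OF Z] B_def[symmetric] T_def[symmetric]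
    using that by (intro sum.mono_neutral_left) (auto intro: vanish)
  have "occupation_prob Z i j s n = (\<Sum>c<Suc n. fps_nth (taboo_fps Z B c i s * T) n)"
    by (rule long) simp
  also have "\<dots> = fps_nth (taboo_fps Z B 0 i s * T) n
      + (\<Sum>c<n. fps_nth (taboo_fps Z B (Suc c) i s * T) n)"
    by (rule sum.lessThan_Suc_shift)
  also have "(\<Sum>c<n. fps_nth (taboo_fps Z B (Suc c) i s * T) n)
      = (\<Sum>c<n. \<Sum>l\<in>-B. \<Sum>m=0..n. kernel Z i l m * fps_nth (taboo_fps Z B c l s * T) (n - m))"
    unfolding taboo_fps_first_step
    by (simp add: sum_distrib_right mult.assoc fps_sum_nth fps_mult_nth[of "Abs_fps _"])
  also have "\<dots> = (\<Sum>l\<in>-B. \<Sum>m=0..n. \<Sum>c<n. kernel Z i l m * fps_nth (taboo_fps Z B c l s * T) (n - m))"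
    by (subst sum.swap, rule sum.cong[OF refl], rule sum.swap)
  also have "\<dots> = (\<Sum>l\<in>-B. \<Sum>m=0..n. kernel Z i l m * occupation_prob Z l j s (n - m))"
  proof (intro sum.cong refl)
    fix l m assume "m \<in> {0..n}"
    then show "(\<Sum>c<n. kernel Z i l m * fps_nth (taboo_fps Z B c l s * T) (n - m))
        = kernel Z i l m * occupation_prob Z l j s (n - m)"
      (* Only m > 0 contributes, and then n - m < n leaves room for the jump that was split off. *)
      by (cases "m = 0") (auto simp: kernel_zero[OF Z] long[of "n - m" n] sum_distrib_left)
  qed
  finally show ?thesis by (auto simp: T_def B_def atLeast0AtMost)
qed

section \<open>Exponentially weighted moments\<close>

definition exp_moment :: "(nat \<Rightarrow> real) \<Rightarrow> real \<Rightarrow> nat \<Rightarrow> real" where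
  "exp_moment f \<rho> r = (\<Sum>n. real n ^ r * exp (\<rho> * real n) * f n)"

text \<open>All moments at once, since a moment of a convolution involves all moments of the factors up to
its order.\<close>

definition exp_summable :: "(nat \<Rightarrow> real) \<Rightarrow> real \<Rightarrow> bool" where
  "exp_summable f \<rho> \<longleftrightarrow> (\<forall>r. summable (\<lambda>n. real n ^ r * exp (\<rho> * real n) * f n))"

lemma exp_moment_sums:
  "exp_summable f \<rho> \<Longrightarrow> (\<lambda>n. real n ^ r * exp (\<rho> * real n) * f n) sums exp_moment f \<rho> r"
  unfolding exp_summable_def exp_moment_def by (blast intro: summable_sums)

text \<open>A smaller exponential rate absorbs every power of \<open>n\<close>, as \<open>n\<^sup>r e\<^bsup>-(\<delta> - \<rho>)n\<^esup>\<close> is bounded.\<close>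

lemma exp_summableI:
  assumes nonneg: "\<And>n. 0 \<le> f n" and sum: "summable (\<lambda>n. exp (\<delta> * real n) * f n)" and "\<rho> < \<delta>"
  shows "exp_summable f \<rho>"
  unfolding exp_summable_def
proof
  fix r
  (* The surplus rate, which absorbs the power of n. *)
  let ?c = "\<delta> - \<rho>"
  have c: "?c > 0" using assms by simp
  have "((\<lambda>x. x ^ r / exp x) \<longlongrightarrow> (0::real)) at_top" by (rule tendsto_power_div_exp_0)
  moreover have "filterlim (\<lambda>n. ?c * real n) at_top sequentially"
    using c filterlim_real_sequentially by (rule filterlim_tendsto_pos_mult_at_top[OF tendsto_const])
  ultimately have "(\<lambda>n. (?c * real n) ^ r / exp (?c * real n)) \<longlonglongrightarrow> 0"
    by (rule filterlim_compose)
  then have "Bseq (\<lambda>n. (?c * real n) ^ r / exp (?c * real n))"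
    by (metis convergentI convergent_imp_Bseq)
  then obtain K where K: "\<And>n. norm ((?c * real n) ^ r / exp (?c * real n)) \<le> K"
    unfolding Bseq_def by auto
  have bound: "real n ^ r * exp (\<rho> * real n) \<le> K / ?c ^ r * exp (\<delta> * real n)" for n
  proof -
    have "\<rho> * real n = \<delta> * real n - ?c * real n" by (simp add: algebra_simps)
    then have "real n ^ r * exp (\<rho> * real n)
        = ((?c * real n) ^ r / exp (?c * real n)) / ?c ^ r * exp (\<delta> * real n)"
      using c by (simp add: exp_diff power_mult_distrib)
    also have "\<dots> \<le> K / ?c ^ r * exp (\<delta> * real n)"
      using K[of n] c by (intro mult_right_mono divide_right_mono) auto
    finally show ?thesis .
  qed
  show "summable (\<lambda>n. real n ^ r * exp (\<rho> * real n) * f n)"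
  proof (rule summable_comparison_test')
    show "summable (\<lambda>n. K / ?c ^ r * (exp (\<delta> * real n) * f n))"
      by (intro summable_mult sum)
    show "norm (real n ^ r * exp (\<rho> * real n) * f n) \<le> K / ?c ^ r * (exp (\<delta> * real n) * f n)" for n
      using mult_right_mono[OF bound nonneg, of n n] nonneg[of n] by (simp add: mult.assoc abs_mult)
  qed
qed

text \<open>Leibniz rule: in the \<open>n\<close>-th term of the convolution \<open>n = i + (n - i)\<close>, so the binomial theorem
splits \<open>n\<^sup>r\<close> and each summand is a Cauchy product of two series.\<close>

lemma exp_moment_convolution:
  assumes f: "exp_summable f \<rho>" "\<And>n. 0 \<le> f n" and g: "exp_summable g \<rho>" "\<And>n. 0 \<le> g n"
  shows "(\<lambda>n. real n ^ r * exp (\<rho> * real n) * (\<Sum>m\<le>n. f m * g (n - m)))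
    sums (\<Sum>m\<le>r. real (r choose m) * (exp_moment f \<rho> m * exp_moment g \<rho> (r - m)))"
proof -
  let ?w = "\<lambda>r n. real n ^ r * exp (\<rho> * real n)"
  have "(\<lambda>n. \<Sum>i\<le>n. (?w p i * f i) * (?w q (n - i) * g (n - i)))
      sums (exp_moment f \<rho> p * exp_moment g \<rho> q)" for p q
    unfolding exp_moment_def
    using f g by (intro Cauchy_product_sums) (simp_all add: exp_summable_def)
  then have "(\<lambda>n. \<Sum>m\<le>r. real (r choose m) *
        (\<Sum>i\<le>n. (?w m i * f i) * (?w (r - m) (n - i) * g (n - i))))
      sums (\<Sum>m\<le>r. real (r choose m) * (exp_moment f \<rho> m * exp_moment g \<rho> (r - m)))"
    by (intro sums_sum sums_mult)
  moreover have "(\<Sum>m\<le>r. real (r choose m) *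
        (\<Sum>i\<le>n. (?w m i * f i) * (?w (r - m) (n - i) * g (n - i))))
      = ?w r n * (\<Sum>m\<le>n. f m * g (n - m))" for n
  proof -
    have "(\<Sum>m\<le>r. real (r choose m) * (\<Sum>i\<le>n. (?w m i * f i) * (?w (r - m) (n - i) * g (n - i))))
      = (\<Sum>i\<le>n. \<Sum>m\<le>r. real (r choose m) * ((?w m i * f i) * (?w (r - m) (n - i) * g (n - i))))"
      unfolding sum_distrib_left by (rule sum.swap)
    also have "\<dots> = (\<Sum>i\<le>n. ?w r n * (f i * g (n - i)))"
    proof (rule sum.cong[OF refl])
      fix i assume "i \<in> {..n}"
      then have n: "real n = real i + real (n - i)" by simp
      have "?w r n = (\<Sum>m\<le>r. real (r choose m) * real i ^ m * real (n - i) ^ (r - m))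
          * (exp (\<rho> * real i) * exp (\<rho> * real (n - i)))"
        by (simp only: n binomial_ring exp_add[symmetric] distrib_left)
      then show "(\<Sum>m\<le>r. real (r choose m) * ((?w m i * f i) * (?w (r - m) (n - i) * g (n - i))))
          = ?w r n * (f i * g (n - i))"
        by (simp add: sum_distrib_left sum_distrib_right mult_ac)
    qed
    finally show ?thesis by (simp add: sum_distrib_left)
  qed
  ultimately show ?thesis by simp
qed

text \<open>Summation by parts: the sum of \<open>(n + 1)\<^sup>r e\<^bsup>\<rho>(n + 1)\<^esup> T n\<close> is computed once with the binomial theorem
and once with the recurrence for \<open>T\<close>. For \<open>r = 0\<close> and \<open>\<rho> \<noteq> 0\<close> it is the familiar
\<open>\<Sum>\<^sub>n e\<^bsup>\<rho>n\<^esup> P(\<kappa> > n) = (E e\<^bsup>\<rho>\<kappa>\<^esup> - 1) / (e\<^bsup>\<rho>\<^esup> - 1)\<close>, and for \<open>r > 0\<close> its derivatives.\<close>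

lemma exp_moment_tail:
  assumes T: "exp_summable T \<rho>" and q: "exp_summable q \<rho>"
    and rec: "\<And>n. T n = T (Suc n) + q (Suc n)" and "T 0 = 1" "q 0 = 0"
  shows "exp \<rho> * (\<Sum>m\<le>r. real (r choose m) * exp_moment T \<rho> m) + (if r = 0 then 1 else 0)
    = exp_moment T \<rho> r + exp_moment q \<rho> r"
proof -
  let ?w = "\<lambda>r n. real n ^ r * exp (\<rho> * real n)"
  have "(\<lambda>n. exp \<rho> * (\<Sum>m\<le>r. real (r choose m) * (?w m n * T n)))
      sums (exp \<rho> * (\<Sum>m\<le>r. real (r choose m) * exp_moment T \<rho> m))"
    by (intro sums_mult sums_sum exp_moment_sums T)
  moreover have "exp \<rho> * (\<Sum>m\<le>r. real (r choose m) * (?w m n * T n)) = ?w r (Suc n) * T n" for n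
    using binomial_ring[of "real n" 1 r]
    by (simp add: exp_add distrib_left sum_distrib_left sum_distrib_right mult_ac add.commute)
  ultimately have 1: "(\<lambda>n. ?w r (Suc n) * T n)
      sums (exp \<rho> * (\<Sum>m\<le>r. real (r choose m) * exp_moment T \<rho> m))" by simp
  have shift: "(\<lambda>n. ?w r (Suc n) * f (Suc n)) sums (exp_moment f \<rho> r - ?w r 0 * f 0)"
    if "exp_summable f \<rho>" for f
    using exp_moment_sums[OF that, of r] sums_Suc_iff[of "\<lambda>n. ?w r n * f n"] by simp
  have "(\<lambda>n. ?w r (Suc n) * T (Suc n) + ?w r (Suc n) * q (Suc n))
      sums (exp_moment T \<rho> r - ?w r 0 * T 0 + (exp_moment q \<rho> r - ?w r 0 * q 0))"
    by (intro sums_add shift T q)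
  moreover have "?w r (Suc n) * T (Suc n) + ?w r (Suc n) * q (Suc n) = ?w r (Suc n) * T n" for n
    by (simp only: rec[of n] distrib_left)
  ultimately have "(\<lambda>n. ?w r (Suc n) * T n)
      sums (exp_moment T \<rho> r - ?w r 0 * T 0 + (exp_moment q \<rho> r - ?w r 0 * q 0))" by simp
  from sums_unique2[OF 1 this] show ?thesis using assms(4,5) by (simp add: power_0_left)
qed

lemma suminf_ennreal_exp_moment:
  assumes "exp_summable f \<rho>" "\<And>n. 0 \<le> f n"
  shows "(\<Sum>n. ennreal (real n ^ r * exp (\<rho> * real n) * f n)) = ennreal (exp_moment f \<rho> r)"
  using assms unfolding exp_summable_def exp_moment_def by (intro suminf_ennreal2) auto

lemma exp_moment_nonneg: "exp_summable f \<rho> \<Longrightarrow> (\<And>n. 0 \<le> f n) \<Longrightarrow> 0 \<le> exp_moment f \<rho> r"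
  unfolding exp_summable_def exp_moment_def by (intro suminf_nonneg) auto

section \<open>Linear equations for the moments of one process\<close>

lemma occupation_prob_nonneg: "0 \<le> occupation_prob Z i j s n"
  by (simp add: occupation_prob_def)

definition omega_vec :: "('n::finite, 'w) mrp \<Rightarrow> 'n \<Rightarrow> 'n \<Rightarrow> real \<Rightarrow> nat \<Rightarrow> real ^ 'n" where
  "omega_vec Z j s \<rho> r = (\<chi> i. enn2real (omega Z (Some i) (Some j) (Some s) \<rho> r))"

definition P_moment :: "('n::finite, 'w) mrp \<Rightarrow> real \<Rightarrow> 'n \<Rightarrow> nat \<Rightarrow> real ^ 'n ^ 'n" where
  "P_moment Z \<rho> j m = (\<chi> i l. if l = j then 0 else enn2real (p_mom Z (Some i) (Some l) \<rho> m))"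

text \<open>The \<open>r\<close>-th derivative at \<open>\<rho>\<close> of \<open>(E\<^sub>i e\<^bsup>\<rho>\<kappa>\<^esup> - 1) / (e\<^bsup>\<rho>\<^esup> - 1)\<close>. As a power series in \<open>e\<^bsup>\<rho>\<^esup>\<close> it
has no singularity at \<open>\<rho> = 0\<close>.\<close>

definition tail_moment :: "('n::finite, 'w) mrp \<Rightarrow> real \<Rightarrow> 'n \<Rightarrow> nat \<Rightarrow> real" where
  "tail_moment Z \<rho> i r = exp_moment (gap_tail Z (Some i)) \<rho> r"

lemma P_mat_eq_P_moment: "P_mat Z \<rho> j = P_moment Z \<rho> j 0"
  by (simp add: P_mat_def P_moment_def)

text \<open>Finiteness of the expected exponential occupation times at rate \<open>\<delta>\<close> controls everything else at
smaller rates: they dominate the tails of the gaps, which in turn dominate the kernel.\<close>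

locale finite_occupation =
  fixes Z :: "('n::finite, 'w) mrp" and \<delta> :: real
  assumes Z: "markov_renewal Z"
    and omega_finite: "\<And>i j s. omega Z (Some i) (Some j) (Some s) \<delta> 0 < \<infinity>"
begin

lemma occupation_summable: "summable (\<lambda>n. exp (\<delta> * real n) * occupation_prob Z (Some i) (Some j) (Some s) n)"
  using omega_finite[of i j s]
  by (intro summable_suminf_not_top) (simp_all add: omega_def occupation_prob_def top.not_eq_extremum)

text \<open>Until the first jump the process stays in its initial state, and nothing has been hit.\<close>

lemma tail_le_occupation: "gap_tail Z i n \<le> occupation_prob Z i j i n"
  unfolding renewal_equation[OF Z, of i j i]
  by (simp add: sum_nonneg kernel_nonneg[OF Z] occupation_prob_nonneg)

lemma tail_summable: "summable (\<lambda>n. exp (\<delta> * real n) * gap_tail Z (Some i) n)"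
  by (rule summable_comparison_test'[OF occupation_summable[of i i i]])
    (simp add: abs_mult gap_tail_nonneg[OF Z] tail_le_occupation)

lemma kernel_exp_summable: "summable (\<lambda>n. exp (\<delta> * real n) * kernel Z (Some i) j n)"
proof (subst summable_Suc_iff[symmetric], rule summable_comparison_test')
  show "summable (\<lambda>n. exp \<delta> * (exp (\<delta> * real n) * gap_tail Z (Some i) n))"
    by (intro summable_mult tail_summable)
  show "norm (exp (\<delta> * real (Suc n)) * kernel Z (Some i) j (Suc n))
      \<le> exp \<delta> * (exp (\<delta> * real n) * gap_tail Z (Some i) n)" for n
  proof -
    have "kernel Z (Some i) j (Suc n) \<le> (\<Sum>l\<in>UNIV. kernel Z (Some i) l (Suc n))"
      by (rule member_le_sum) (auto simp: kernel_nonneg[OF Z])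
    also have "\<dots> \<le> gap_tail Z (Some i) n"
      unfolding gap_tail_Suc[of Z "Some i" n] using gap_tail_nonneg[OF Z] by simp
    finally show ?thesis
      by (simp add: abs_mult kernel_nonneg[OF Z] distrib_left exp_add)
  qed
qed

context
  fixes \<rho> :: real
  assumes \<rho>: "\<rho> < \<delta>"
begin

lemma exp_summable_occupation: "exp_summable (occupation_prob Z (Some i) (Some j) (Some s)) \<rho>"
  by (rule exp_summableI[OF occupation_prob_nonneg occupation_summable \<rho>])

lemma exp_summable_tail: "exp_summable (gap_tail Z (Some i)) \<rho>"
  by (rule exp_summableI[OF gap_tail_nonneg[OF Z] tail_summable \<rho>])

lemma exp_summable_kernel: "exp_summable (kernel Z (Some i) j) \<rho>"
  by (rule exp_summableI[OF kernel_nonneg[OF Z] kernel_exp_summable \<rho>])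

lemma omega_eq_exp_moment:
  "omega Z (Some i) (Some j) (Some s) \<rho> r
     = ennreal (exp_moment (occupation_prob Z (Some i) (Some j) (Some s)) \<rho> r)"
  unfolding omega_def occupation_prob_def[symmetric]
  by (rule suminf_ennreal_exp_moment[OF exp_summable_occupation occupation_prob_nonneg])

lemma p_mom_eq_exp_moment:
  "p_mom Z (Some i) j \<rho> r = ennreal (exp_moment (kernel Z (Some i) j) \<rho> r)"
  unfolding p_mom_def
  by (rule suminf_ennreal_exp_moment[OF exp_summable_kernel kernel_nonneg[OF Z]])

lemma omega_vec_nth:
  "omega_vec Z j s \<rho> r $ i = exp_moment (occupation_prob Z (Some i) (Some j) (Some s)) \<rho> r"
  by (simp add: omega_vec_def omega_eq_exp_moment
      exp_moment_nonneg[OF exp_summable_occupation occupation_prob_nonneg])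

lemma P_moment_nth:
  "P_moment Z \<rho> j m $ i $ l = (if l = j then 0 else exp_moment (kernel Z (Some i) (Some l)) \<rho> m)"
  by (simp add: P_moment_def p_mom_eq_exp_moment
      exp_moment_nonneg[OF exp_summable_kernel kernel_nonneg[OF Z]])

text \<open>The moments of order \<open>r\<close> of both sides of the renewal equation.\<close>

lemma omega_system:
  "omega_vec Z j s \<rho> r = (\<chi> i. if i = s then tail_moment Z \<rho> i r else 0)
     + (\<Sum>m\<le>r. real (r choose m) *\<^sub>R (P_moment Z \<rho> j m *v omega_vec Z j s \<rho> (r - m)))"
proof (rule vec_eq_iff[THEN iffD2], rule allI)
  fix i
  let ?h = "\<lambda>l. occupation_prob Z (Some l) (Some j) (Some s)"
  let ?Q = "\<lambda>l. kernel Z (Some i) (Some l)"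
  let ?w = "\<lambda>n. real n ^ r * exp (\<rho> * real n)"
  have compl: "- {None, Some j} = Some ` (- {j})" by (auto simp: image_iff)
  have h: "?h i n = (if i = s then gap_tail Z (Some s) n else 0)
      + (\<Sum>l\<in>-{j}. \<Sum>m\<le>n. ?Q l m * ?h l (n - m))" for n
    unfolding renewal_equation[OF Z, of "Some i"] compl by (simp add: sum.reindex)
  have "(\<lambda>n. ?w n * ?h i n) sums ((if i = s then tail_moment Z \<rho> i r else 0)
      + (\<Sum>l\<in>-{j}. \<Sum>m\<le>r. real (r choose m) * (exp_moment (?Q l) \<rho> m * exp_moment (?h l) \<rho> (r - m))))"
  proof -
    have "(\<lambda>n. ?w n * (if i = s then gap_tail Z (Some s) n else 0))
        sums (if i = s then tail_moment Z \<rho> i r else 0)"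
      using exp_moment_sums[OF exp_summable_tail, of r s] by (simp add: tail_moment_def)
    moreover have "(\<lambda>n. \<Sum>l\<in>-{j}. ?w n * (\<Sum>m\<le>n. ?Q l m * ?h l (n - m))) sums
        (\<Sum>l\<in>-{j}. \<Sum>m\<le>r. real (r choose m) * (exp_moment (?Q l) \<rho> m * exp_moment (?h l) \<rho> (r - m)))"
      by (intro sums_sum exp_moment_convolution exp_summable_kernel exp_summable_occupation
          kernel_nonneg[OF Z] occupation_prob_nonneg)
    ultimately show ?thesis
      unfolding h distrib_left sum_distrib_left by (rule sums_add)
  qed
  then have "omega_vec Z j s \<rho> r $ i = (if i = s then tail_moment Z \<rho> i r else 0)
      + (\<Sum>l\<in>-{j}. \<Sum>m\<le>r. real (r choose m) * (exp_moment (?Q l) \<rho> m * exp_moment (?h l) \<rho> (r - m)))"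
    unfolding omega_vec_nth exp_moment_def[of "?h i"] by (rule sums_unique[symmetric])
  also have "(\<Sum>l\<in>-{j}. \<Sum>m\<le>r. real (r choose m) * (exp_moment (?Q l) \<rho> m * exp_moment (?h l) \<rho> (r - m)))
      = (\<Sum>m\<le>r. real (r choose m) * (\<Sum>l\<in>-{j}. exp_moment (?Q l) \<rho> m * exp_moment (?h l) \<rho> (r - m)))"
    unfolding sum_distrib_left by (rule sum.swap)
  also have "\<dots> = (\<Sum>m\<le>r. real (r choose m) * (P_moment Z \<rho> j m *v omega_vec Z j s \<rho> (r - m)) $ i)"
  proof -
    have "(\<Sum>l\<in>-{j}. exp_moment (?Q l) \<rho> m * exp_moment (?h l) \<rho> (r - m))
        = (P_moment Z \<rho> j m *v omega_vec Z j s \<rho> (r - m)) $ i" for m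
      unfolding matrix_vector_mult_def vec_lambda_beta P_moment_nth omega_vec_nth
      by (intro sum.mono_neutral_cong_left) auto
    then show ?thesis by simp
  qed
  finally show "omega_vec Z j s \<rho> r $ i = ((\<chi> i. if i = s then tail_moment Z \<rho> i r else 0)
     + (\<Sum>m\<le>r. real (r choose m) *\<^sub>R (P_moment Z \<rho> j m *v omega_vec Z j s \<rho> (r - m)))) $ i"
    by simp
qed

lemma tail_moment_recursion:
  "exp \<rho> * (\<Sum>m\<le>r. real (r choose m) * tail_moment Z \<rho> i m) + (if r = 0 then 1 else 0)
     = tail_moment Z \<rho> i r + (\<Sum>j\<in>UNIV. enn2real (p_mom Z (Some i) j \<rho> r))"
proof -
  let ?q = "\<lambda>n. \<Sum>j\<in>UNIV. kernel Z (Some i) j n"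
  have q: "(\<lambda>n. real n ^ r * exp (\<rho> * real n) * ?q n) sums (\<Sum>j\<in>UNIV. exp_moment (kernel Z (Some i) j) \<rho> r)" for r
    unfolding sum_distrib_left by (intro sums_sum exp_moment_sums exp_summable_kernel)
  then have "exp_summable ?q \<rho>" unfolding exp_summable_def by (blast intro: sums_summable)
  from exp_moment_tail[OF exp_summable_tail this gap_tail_Suc gap_tail_0[OF Z], of r]
  have "exp \<rho> * (\<Sum>m\<le>r. real (r choose m) * tail_moment Z \<rho> i m) + (if r = 0 then 1 else 0)
     = tail_moment Z \<rho> i r + exp_moment ?q \<rho> r"
    by (simp add: tail_moment_def kernel_zero[OF Z])
  also have "exp_moment ?q \<rho> r = (\<Sum>j\<in>UNIV. enn2real (p_mom Z (Some i) j \<rho> r))"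
    unfolding exp_moment_def[of ?q] sums_unique[OF q, symmetric]
    by (simp add: p_mom_eq_exp_moment exp_moment_nonneg[OF exp_summable_kernel kernel_nonneg[OF Z]])
  finally show ?thesis .
qed

text \<open>The term \<open>n = 0\<close> of the series is \<open>1\<close>.\<close>

lemma tail_moment_ge_1: "1 \<le> tail_moment Z \<rho> i 0"
proof -
  let ?f = "\<lambda>n. real n ^ 0 * exp (\<rho> * real n) * gap_tail Z (Some i) n"
  have "sum ?f {0} \<le> suminf ?f"
    using exp_summable_tail[of i] unfolding exp_summable_def
    by (intro sum_le_suminf) (blast, auto simp: gap_tail_nonneg[OF Z])
  then show ?thesis by (simp add: tail_moment_def exp_moment_def gap_tail_0[OF Z])
qed

text \<open>For \<open>r = 0\<close>, \<open>omega_system\<close> says that \<open>I - P(\<rho>)\<close> maps the vector for the state \<open>s\<close> to a positive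
multiple of the \<open>s\<close>-th unit vector.\<close>

lemma resolvent_right_inverse:
  "(mat 1 - P_mat Z \<rho> j) ** (\<chi> i s. omega_vec Z j s \<rho> 0 $ i / tail_moment Z \<rho> s 0) = mat 1"
proof -
  let ?R = "\<chi> i s. omega_vec Z j s \<rho> 0 $ i / tail_moment Z \<rho> s 0"
  have "((mat 1 - P_mat Z \<rho> j) ** ?R) $ i $ s = (mat 1 :: real ^ 'n ^ 'n) $ i $ s" for i s
  proof -
    have "((mat 1 - P_mat Z \<rho> j) ** ?R) $ i $ s
        = ((mat 1 - P_mat Z \<rho> j) *v omega_vec Z j s \<rho> 0) $ i / tail_moment Z \<rho> s 0"
      by (simp add: matrix_matrix_mult_def matrix_vector_mult_def sum_divide_distrib)
    also have "(mat 1 - P_mat Z \<rho> j) *v omega_vec Z j s \<rho> 0 = (\<chi> i. if i = s then tail_moment Z \<rho> i 0 else 0)"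
      using omega_system[of j s 0]
      by (simp add: matrix_vector_mult_diff_rdistrib P_mat_eq_P_moment algebra_simps)
    finally show ?thesis using tail_moment_ge_1[of s] by (auto simp: mat_def)
  qed
  then show ?thesis by (simp add: vec_eq_iff)
qed

lemma resolvent_inverse:
  shows "invertible (mat 1 - P_mat Z \<rho> j)"
    and "matrix_inv (mat 1 - P_mat Z \<rho> j) = (\<chi> i s. omega_vec Z j s \<rho> 0 $ i / tail_moment Z \<rho> s 0)"
proof -
  show inv: "invertible (mat 1 - P_mat Z \<rho> j)"
    using resolvent_right_inverse invertible_right_inverse by blast
  show "matrix_inv (mat 1 - P_mat Z \<rho> j) = (\<chi> i s. omega_vec Z j s \<rho> 0 $ i / tail_moment Z \<rho> s 0)"
    by (rule matrix_inv_unique_right[OF resolvent_right_inverse])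
qed

lemma omega_vec_solution:
  "omega_vec Z j s \<rho> r = matrix_inv (mat 1 - P_mat Z \<rho> j) *v
     ((\<chi> i. if i = s then tail_moment Z \<rho> i r else 0)
      + (\<Sum>m=1..r. real (r choose m) *\<^sub>R (P_moment Z \<rho> j m *v omega_vec Z j s \<rho> (r - m))))"
proof -
  have "(mat 1 - P_mat Z \<rho> j) *v omega_vec Z j s \<rho> r = (\<chi> i. if i = s then tail_moment Z \<rho> i r else 0)
      + (\<Sum>m=1..r. real (r choose m) *\<^sub>R (P_moment Z \<rho> j m *v omega_vec Z j s \<rho> (r - m)))"
    using omega_system[of j s r]
    by (simp add: matrix_vector_mult_diff_rdistrib P_mat_eq_P_moment atMost_atLeast0
        sum.atLeast_Suc_atMost algebra_simps)
  then have "matrix_inv (mat 1 - P_mat Z \<rho> j) *v ((mat 1 - P_mat Z \<rho> j) *v omega_vec Z j s \<rho> r)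
      = matrix_inv (mat 1 - P_mat Z \<rho> j) *v ((\<chi> i. if i = s then tail_moment Z \<rho> i r else 0)
      + (\<Sum>m=1..r. real (r choose m) *\<^sub>R (P_moment Z \<rho> j m *v omega_vec Z j s \<rho> (r - m))))"
    by (rule arg_cong)
  then show ?thesis
    by (simp only: matrix_vector_mul_assoc matrix_inv_mult_left[OF resolvent_inverse(1)] matrix_vector_mul_lid)
qed

end

end

section \<open>Expansions for the perturbed family\<close>

lemma cond_P_expansion:
  assumes "cond_P Z \<rho> k a" "r \<le> k"
  shows "expansion (\<lambda>\<epsilon>. enn2real (p_mom (Z \<epsilon>) (Some i) j \<rho> r)) (a i j r) (k - r)"
  using assms by (simp add: cond_P_def expands_iff_expansion)

lemma expansion_psi:
  assumes "cond_P Z \<rho> k a" "r \<le> k"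
  shows "expansion (\<lambda>\<epsilon>. \<Sum>j\<in>UNIV. enn2real (p_mom (Z \<epsilon>) (Some i) j \<rho> r)) (psi_coeff a i r) (k - r)"
  unfolding psi_coeff_def[abs_def] by (intro expansion_sum cond_P_expansion[OF assms]) simp

lemma expansion_P_moment:
  assumes "cond_P Z \<rho> k a" "r \<le> k"
  shows "expansion (\<lambda>\<epsilon>. P_moment (Z \<epsilon>) \<rho> j r) (P_coeff a j r) (k - r)"
  unfolding expansion_vec_iff P_moment_def P_coeff_def
  unfolding vec_lambda_beta
  by (intro allI expansion_if expansion_zero cond_P_expansion[OF assms])

text \<open>The stronger form of the expansion condition, assumed for \<open>\<rho> = 0\<close>, contains the weaker one, so
that the two cases differ only in the expansion of the tail moments.\<close>

lemma cond_P_Suc_imp: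
  assumes "cond_P Z \<rho> (k + 1) a"
  shows "cond_P Z \<rho> k a"
  unfolding cond_P_def
proof (intro allI impI)
  fix r i j
  assume "r \<le> k"
  then have "expands (\<lambda>\<epsilon>. p_mom (Z \<epsilon>) (Some i) j \<rho> r) (a i j r) (Suc (k - r))"
    using assms[unfolded cond_P_def, rule_format, of r i j] by (simp add: Suc_diff_le)
  then show "expands (\<lambda>\<epsilon>. p_mom (Z \<epsilon>) (Some i) j \<rho> r) (a i j r) (k - r)"
    by (auto simp: expands_iff_expansion intro: expansion_Suc_imp)
qed

text \<open>Solve \<open>tail_moment_recursion\<close> for the leading moment. If \<open>\<rho> = 0\<close>, the moment of order \<open>r\<close> cancels from
the equation of order \<open>r\<close>, and one has to use the equation of order \<open>r + 1\<close> instead: this costs one more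
moment of the kernel.\<close>

lemma expansion_tail_moment:
  assumes ev: "\<forall>\<^sub>F \<epsilon> in at_right 0. finite_occupation (Z \<epsilon>) \<delta>" and at0: "finite_occupation (Z 0) \<delta>"
    and \<rho>: "\<rho> < \<delta>"
    and P0: "\<rho> = 0 \<Longrightarrow> cond_P Z \<rho> (k + 1) a" and P: "\<rho> \<noteq> 0 \<Longrightarrow> cond_P Z \<rho> k a"
  shows "r \<le> k \<Longrightarrow> expansion (\<lambda>\<epsilon>. tail_moment (Z \<epsilon>) \<rho> i r) (varphi_coeff a \<rho> i r) (k - r)"
proof (induction r rule: less_induct)
  case (less r)
  let ?\<psi> = "\<lambda>r \<epsilon>. \<Sum>j\<in>UNIV. enn2real (p_mom (Z \<epsilon>) (Some i) j \<rho> r)"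
  let ?\<phi> = "\<lambda>r \<epsilon>. tail_moment (Z \<epsilon>) \<rho> i r"
  have IH: "expansion (\<lambda>\<epsilon>. \<Sum>m<r. b m * ?\<phi> m \<epsilon>) (\<lambda>n. \<Sum>m<r. b m * varphi_coeff a \<rho> i m n) (k - r)"
    for b :: "nat \<Rightarrow> real"
  proof (intro expansion_sum expansion_cmult)
    fix m assume "m \<in> {..<r}"
    then show "expansion (?\<phi> m) (varphi_coeff a \<rho> i m) (k - r)"
      using less.IH[of m] less.prems by (auto intro: expansion_le)
  qed simp
  show ?case
  proof (cases "\<rho> = 0")
    case True
    have eq: "?\<phi> r \<epsilon> = 1 / real (r + 1) * (?\<psi> (r + 1) \<epsilon> - (\<Sum>m<r. real ((r + 1) choose m) * ?\<phi> m \<epsilon>))"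
      if "finite_occupation (Z \<epsilon>) \<delta>" for \<epsilon>
      using finite_occupation.tail_moment_recursion[OF that \<rho>, of "r + 1" i] True
      by (simp add: lessThan_Suc_atMost[symmetric] field_simps)
    have "expansion (?\<psi> (r + 1)) (psi_coeff a i (r + 1)) (k - r)"
      using expansion_psi[OF P0[OF True], of "r + 1" i] less.prems by simp
    then have "expansion (\<lambda>\<epsilon>. 1 / real (r + 1) * (?\<psi> (r + 1) \<epsilon> - (\<Sum>m<r. real ((r + 1) choose m) * ?\<phi> m \<epsilon>)))
      (\<lambda>n. 1 / real (r + 1) * (psi_coeff a i (r + 1) n - (\<Sum>m<r. real ((r + 1) choose m) * varphi_coeff a \<rho> i m n)))
      (k - r)"
      by (intro expansion_cmult expansion_diff IH)
    then show ?thesis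
    proof (rule expansion_cong)
      show "\<forall>\<^sub>F \<epsilon> in at_right 0. 1 / real (r + 1) * (?\<psi> (r + 1) \<epsilon>
          - (\<Sum>m<r. real ((r + 1) choose m) * ?\<phi> m \<epsilon>)) = ?\<phi> r \<epsilon>"
        using ev by eventually_elim (rule eq[symmetric])
      show "1 / real (r + 1) * (psi_coeff a i (r + 1) n
          - (\<Sum>m<r. real ((r + 1) choose m) * varphi_coeff a \<rho> i m n)) = varphi_coeff a \<rho> i r n" for n
        using True by (simp add: varphi_coeff.simps[of a 0 i r n])
    qed (rule eq[OF at0, symmetric])
  next
    case False
    then have e: "exp \<rho> - 1 \<noteq> 0" by simp
    have eq: "?\<phi> r \<epsilon> = 1 / (exp \<rho> - 1) * (?\<psi> r \<epsilon> - (if r = 0 then 1 else 0)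
        - exp \<rho> * (\<Sum>m<r. real (r choose m) * ?\<phi> m \<epsilon>))"
      if "finite_occupation (Z \<epsilon>) \<delta>" for \<epsilon>
    proof -
      have "(exp \<rho> - 1) * ?\<phi> r \<epsilon> = ?\<psi> r \<epsilon> - (if r = 0 then 1 else 0)
        - exp \<rho> * (\<Sum>m<r. real (r choose m) * ?\<phi> m \<epsilon>)"
        using finite_occupation.tail_moment_recursion[OF that \<rho>, of r i]
        by (simp add: lessThan_Suc_atMost[symmetric] algebra_simps)
      then show ?thesis using e by (simp add: field_simps)
    qed
    have "expansion (\<lambda>\<epsilon>. 1 / (exp \<rho> - 1) * (?\<psi> r \<epsilon> - (if r = 0 then 1 else 0)
        - exp \<rho> * (\<Sum>m<r. real (r choose m) * ?\<phi> m \<epsilon>)))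
      (\<lambda>n. 1 / (exp \<rho> - 1) * (psi_coeff a i r n - (if n = 0 then if r = 0 then 1 else 0 else 0)
        - exp \<rho> * (\<Sum>m<r. real (r choose m) * varphi_coeff a \<rho> i m n))) (k - r)"
      by (intro expansion_cmult expansion_diff IH expansion_const expansion_psi[OF P[OF False] less.prems])
    then show ?thesis
    proof (rule expansion_cong)
      show "\<forall>\<^sub>F \<epsilon> in at_right 0. 1 / (exp \<rho> - 1) * (?\<psi> r \<epsilon> - (if r = 0 then 1 else 0)
        - exp \<rho> * (\<Sum>m<r. real (r choose m) * ?\<phi> m \<epsilon>)) = ?\<phi> r \<epsilon>"
        using ev by eventually_elim (rule eq[symmetric])
      show "1 / (exp \<rho> - 1) * (psi_coeff a i r n - (if n = 0 then if r = 0 then 1 else 0 else 0)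
        - exp \<rho> * (\<Sum>m<r. real (r choose m) * varphi_coeff a \<rho> i m n)) = varphi_coeff a \<rho> i r n" for n
        using False by (simp add: varphi_coeff.simps[of a \<rho> i r n])
    qed (simp only: eq[OF at0, symmetric])
  qed
qed

text \<open>The entries of the inverse are the quotients in \<open>resolvent_inverse\<close>, whose denominators stay away
from zero; this gives the continuity from which \<open>expansion_resolvent\<close> starts.\<close>

lemma expansion_resolvent_U_coeff:
  assumes ev: "\<forall>\<^sub>F \<epsilon> in at_right 0. finite_occupation (Z \<epsilon>) \<delta>" and at0: "finite_occupation (Z 0) \<delta>"
    and \<rho>: "\<rho> < \<delta>" and P: "cond_P Z \<rho> k a"
    and lim_tail: "\<And>s. ((\<lambda>\<epsilon>. tail_moment (Z \<epsilon>) \<rho> s 0) \<longlongrightarrow> tail_moment (Z 0) \<rho> s 0) (at_right 0)"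
    and lim_omega: "\<And>s. ((\<lambda>\<epsilon>. omega_vec (Z \<epsilon>) j s \<rho> 0) \<longlongrightarrow> omega_vec (Z 0) j s \<rho> 0) (at_right 0)"
  shows "expansion (\<lambda>\<epsilon>. matrix_inv (mat 1 - P_mat (Z \<epsilon>) \<rho> j)) (U_coeff Z a \<rho> j) k"
proof (rule expansion_resolvent)
  note inv = finite_occupation.resolvent_inverse[OF _ \<rho>]
  show "invertible (mat 1 - P_mat (Z 0) \<rho> j)" by (rule inv(1)[OF at0])
  show "\<forall>\<^sub>F \<epsilon> in at_right 0. invertible (mat 1 - P_mat (Z \<epsilon>) \<rho> j)"
    using ev by eventually_elim (rule inv(1))
  show "expansion (\<lambda>\<epsilon>. P_mat (Z \<epsilon>) \<rho> j) (P_coeff a j 0) k"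
    using expansion_P_moment[OF P, of 0 j] by (simp add: P_mat_eq_P_moment)
  let ?R = "\<lambda>\<epsilon>. \<chi> i s. omega_vec (Z \<epsilon>) j s \<rho> 0 $ i / tail_moment (Z \<epsilon>) \<rho> s 0"
  have "tail_moment (Z 0) \<rho> s 0 \<noteq> 0" for s
    using finite_occupation.tail_moment_ge_1[OF at0 \<rho>, of s] by simp
  then have "(?R \<longlongrightarrow> ?R 0) (at_right 0)"
    by (intro vec_tendstoI) (simp add: tendsto_divide lim_tail tendsto_vec_nth lim_omega)
  moreover have "\<forall>\<^sub>F \<epsilon> in at_right 0. ?R \<epsilon> = matrix_inv (mat 1 - P_mat (Z \<epsilon>) \<rho> j)"
    using ev by eventually_elim (rule inv(2)[symmetric])
  ultimately show "((\<lambda>\<epsilon>. matrix_inv (mat 1 - P_mat (Z \<epsilon>) \<rho> j))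
      \<longlongrightarrow> matrix_inv (mat 1 - P_mat (Z 0) \<rho> j)) (at_right 0)"
    by (simp add: inv(2)[OF at0] tendsto_cong)
qed (simp_all add: U_coeff.simps)

text \<open>The coefficient of order \<open>0\<close> is defined as the unperturbed value, not by the product formula; the
two agree because the linear equations also hold at \<open>\<epsilon> = 0\<close>.\<close>

lemma expansion_omega_vec:
  assumes ev: "\<forall>\<^sub>F \<epsilon> in at_right 0. finite_occupation (Z \<epsilon>) \<delta>" and at0: "finite_occupation (Z 0) \<delta>"
    and \<rho>: "\<rho> < \<delta>" and P: "cond_P Z \<rho> k a"
    and tail: "\<And>i r. r \<le> k \<Longrightarrow> expansion (\<lambda>\<epsilon>. tail_moment (Z \<epsilon>) \<rho> i r) (varphi_coeff a \<rho> i r) (k - r)"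
    and U: "expansion (\<lambda>\<epsilon>. matrix_inv (mat 1 - P_mat (Z \<epsilon>) \<rho> j)) (U_coeff Z a \<rho> j) k"
  shows "r \<le> k \<Longrightarrow> expansion (\<lambda>\<epsilon>. omega_vec (Z \<epsilon>) j s \<rho> r) (omega_coeff Z a \<rho> j s r) (k - r)"
proof (induction r rule: less_induct)
  case (less r)
  let ?\<theta> = "\<lambda>\<epsilon>. (\<chi> i. if i = s then tail_moment (Z \<epsilon>) \<rho> i r else 0)
      + (\<Sum>m=1..r. real (r choose m) *\<^sub>R (P_moment (Z \<epsilon>) \<rho> j m *v omega_vec (Z \<epsilon>) j s \<rho> (r - m)))"
  let ?V = "\<lambda>\<epsilon>. matrix_inv (mat 1 - P_mat (Z \<epsilon>) \<rho> j)"
  note solution = finite_occupation.omega_vec_solution[OF _ \<rho>, of _ j s r]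
  have "expansion (\<lambda>\<epsilon>. \<chi> i. if i = s then tail_moment (Z \<epsilon>) \<rho> i r else 0) (varphi_hat a \<rho> s r) (k - r)"
    unfolding expansion_vec_iff varphi_hat_def
    unfolding vec_lambda_beta by (intro allI expansion_if expansion_zero tail[OF less.prems])
  moreover have "expansion
      (\<lambda>\<epsilon>. \<Sum>m=1..r. real (r choose m) *\<^sub>R (P_moment (Z \<epsilon>) \<rho> j m *v omega_vec (Z \<epsilon>) j s \<rho> (r - m)))
      (\<lambda>n. \<Sum>m=1..r. real (r choose m) *\<^sub>R
        (\<Sum>q=0..n. P_coeff a j m q *v omega_coeff Z a \<rho> j s (r - m) (n - q))) (k - r)"
  proof (intro expansion_sum expansion_bounded_linear[OF bounded_linear_scaleR_right]
      expansion_bilinear[OF bounded_bilinear_matrix_vector_mult])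
    fix m assume m: "m \<in> {1..r}"
    show "expansion (\<lambda>\<epsilon>. P_moment (Z \<epsilon>) \<rho> j m) (P_coeff a j m) (k - r)"
      by (rule expansion_le[OF expansion_P_moment[OF P]]) (use m less.prems in auto)
    show "expansion (\<lambda>\<epsilon>. omega_vec (Z \<epsilon>) j s \<rho> (r - m)) (omega_coeff Z a \<rho> j s (r - m)) (k - r)"
      by (rule expansion_le[OF less.IH]) (use m less.prems in auto)
  qed simp
  ultimately have \<theta>: "expansion ?\<theta> (theta_coeff Z a \<rho> j s r) (k - r)"
    unfolding theta_coeff.simps[abs_def] by (rule expansion_add)
  have *: "expansion (\<lambda>\<epsilon>. ?V \<epsilon> *v ?\<theta> \<epsilon>)
      (\<lambda>n. \<Sum>q=0..n. U_coeff Z a \<rho> j q *v theta_coeff Z a \<rho> j s r (n - q)) (k - r)"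
    by (intro expansion_bilinear[OF bounded_bilinear_matrix_vector_mult] \<theta> expansion_le[OF U]) simp
  show ?case
  proof (rule expansion_cong[OF *])
    show "\<forall>\<^sub>F \<epsilon> in at_right 0. ?V \<epsilon> *v ?\<theta> \<epsilon> = omega_vec (Z \<epsilon>) j s \<rho> r"
      using ev by eventually_elim (rule solution[symmetric])
    show at_0: "?V 0 *v ?\<theta> 0 = omega_vec (Z 0) j s \<rho> r"
      by (rule solution[OF at0, symmetric])
    show "(\<Sum>q=0..n. U_coeff Z a \<rho> j q *v theta_coeff Z a \<rho> j s r (n - q)) = omega_coeff Z a \<rho> j s r n" for n
    proof (cases "n = 0")
      case True
      then show ?thesis
        using expansion_at_0[OF *] at_0 by (simp add: omega_coeff.simps omega_vec_def)
    next
      case False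
      then show ?thesis by (simp add: omega_coeff.simps[of Z a \<rho> j s r n] theta_coeff.simps[of _ _ _ _ _ 0])
    qed
  qed
qed

theorem theorem2:
  fixes Z :: "real \<Rightarrow> ('n::finite, 'w) mrp"
    and a :: "'n \<Rightarrow> 'n option \<Rightarrow> nat \<Rightarrow> nat \<Rightarrow> real"
    and \<beta> \<delta> \<rho> :: real and k :: nat and j s :: 'n
  assumes "\<And>\<epsilon>. \<epsilon> \<ge> 0 \<Longrightarrow> markov_renewal (Z \<epsilon>)"
    and "cond_A Z" and "cond_B Z" and "cond_C Z \<beta>"
    and "delta_param Z \<beta> \<delta>" and "\<rho> < \<delta>"
    and "\<rho> = 0 \<Longrightarrow> cond_P Z \<rho> (k + 1) a"
    and "\<rho> \<noteq> 0 \<Longrightarrow> cond_P Z \<rho> k a"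
  shows "expands_vec (\<lambda>\<epsilon> i. omega (Z \<epsilon>) (Some i) (Some j) (Some s) \<rho> 0)
           (omega_coeff Z a \<rho> j s 0) k \<and>
         (\<forall>r\<in>{1..k}. expands_vec (\<lambda>\<epsilon> i. omega (Z \<epsilon>) (Some i) (Some j) (Some s) \<rho> r)
           (omega_coeff Z a \<rho> j s r) (k - r))"
proof -
  have lim: "((\<lambda>\<epsilon>. omega (Z \<epsilon>) (Some i) (Some j) (Some s) x 0)
        \<longlongrightarrow> omega (Z 0) (Some i) (Some j) (Some s) x 0) (at_right 0)"
    and fin: "omega (Z 0) (Some i) (Some j) (Some s) x 0 < \<infinity>" if "x \<le> \<delta>" for x i j s
    using assms(5) that unfolding delta_param_def by blast+
  have at0: "finite_occupation (Z 0) \<delta>"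
    using assms(1) fin by (auto simp: finite_occupation_def)
  have "\<forall>\<^sub>F \<epsilon> in at_right 0. \<forall>i j s. omega (Z \<epsilon>) (Some i) (Some j) (Some s) \<delta> 0 < \<infinity>"
    by (intro eventually_all_finite order_tendstoD(2)[OF lim] fin) simp_all
  then have ev: "\<forall>\<^sub>F \<epsilon> in at_right 0. finite_occupation (Z \<epsilon>) \<delta>"
    using eventually_at_right_less[of "0::real"]
    by eventually_elim (use assms(1) in \<open>auto simp: finite_occupation_def\<close>)
  have P: "cond_P Z \<rho> k a" using assms(7,8) cond_P_Suc_imp by blast
  have tail: "expansion (\<lambda>\<epsilon>. tail_moment (Z \<epsilon>) \<rho> i r) (varphi_coeff a \<rho> i r) (k - r)" if "r \<le> k" for i r
    by (rule expansion_tail_moment[OF ev at0 assms(6-8) that])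
  have "expansion (\<lambda>\<epsilon>. matrix_inv (mat 1 - P_mat (Z \<epsilon>) \<rho> j)) (U_coeff Z a \<rho> j) k"
  proof (rule expansion_resolvent_U_coeff[OF ev at0 assms(6) P])
    show "((\<lambda>\<epsilon>. tail_moment (Z \<epsilon>) \<rho> s 0) \<longlongrightarrow> tail_moment (Z 0) \<rho> s 0) (at_right 0)" for s
      using expansion_tendsto[OF tail] expansion_at_0[OF tail] by (metis zero_le)
    show "((\<lambda>\<epsilon>. omega_vec (Z \<epsilon>) j s \<rho> 0) \<longlongrightarrow> omega_vec (Z 0) j s \<rho> 0) (at_right 0)" for s
      using lim fin assms(6) unfolding omega_vec_def
      by (intro vec_tendstoI) (auto intro!: tendsto_enn2real simp: less_top[symmetric])
  qed
  from expansion_omega_vec[OF ev at0 assms(6) P tail this]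
  have expn: "expansion (\<lambda>\<epsilon>. omega_vec (Z \<epsilon>) j s \<rho> r) (omega_coeff Z a \<rho> j s r) (k - r)" if "r \<le> k" for r
    using that by blast
  have omega_fin: "omega (Z \<epsilon>) (Some i) (Some j) (Some s) \<rho> r < \<infinity>" if "finite_occupation (Z \<epsilon>) \<delta>" for \<epsilon> i r
    using finite_occupation.omega_eq_exp_moment[OF that assms(6)] by simp
  have "expands_vec (\<lambda>\<epsilon> i. omega (Z \<epsilon>) (Some i) (Some j) (Some s) \<rho> r) (omega_coeff Z a \<rho> j s r) (k - r)"
    if "r \<le> k" for r
    unfolding expands_vec_def expands_iff_expansion
    using expn[OF that] omega_fin at0 eventually_mono[OF ev omega_fin]
    by (auto simp: expansion_vec_iff omega_vec_def)
  from this[of 0] this show ?thesis by auto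
qed

end
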